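(* Let $2\le s\le n$ and let $F$ be a monic hyperbolic polynomial of degree $n$ such that $\mathcal H_s(F)$ is generic. Let $\Phi_1,\dots,\Phi_k$ be the facets of the boundary complex $\partial(\mathcal L_s^\Delta(F))$, i.e. the zero-dimensional strata $\mathcal H_s^{\gamma_1}(F),\dots,\mathcal H_s^{\gamma_k}(F)$, where $\gamma_1,\dots,\gamma_k$ are the compositions of length $s$ that occur in $\mathcal H_s(F)$. Let $\le$ be a total order on $\{\Phi_1,\dots,\Phi_k\}$ that is finer than $\le_p$. Then $\le$, and also its reverse order, induces a shelling of $\partial(\mathcal L_s^\Delta(F))$.
   Context: A univariate real polynomial is hyperbolic if all its roots are real; $\mathcal H$ is the set of monic hyperbolic polynomials of degree $n$ in $\mathbb R[T]$. For $F=T^n+F_1T^{n-1}+\dots+F_n\in\mathcal H$, the hyperbolic slice is $\mathcal H_s(F)=\{T^n+H_1T^{n-1}+\dots+H_n\in\mathcal H : H_i=F_i \text{ for } 1\le i\le s\}$. It is generic if it contains no polynomial with at most $s-1$ distinct roots. A composition of $n$ is a finite sequence of positive integers with sum $n$; its length is the number of parts. $\mu\le\lambda$ means $\mu$ is obtained from $\lambda$ by summing consecutive blocks of entries. The composition $c(H)$ of $H\in\mathcal H$ is the sequence of multiplicities of its distinct roots listed in increasing order of the roots. A composition $\mu$ occurs in $\mathcal H_s(F)$ if $\mu=c(H)$ for some $H\in\mathcal H_s(F)$. The strata are $\mathcal H_s^\mu(F)=\{H\in\mathcal H_s(F): c(H)\le\mu\}$; dimension is the dimension as semialgebraic set. $\mathcal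 L_s(F)$ is the poset of strata ordered by inclusion, $\mathcal L_s^\Delta(F)$ is the dual poset (reverse inclusion), and the boundary complex is $\partial(\mathcal L_s^\Delta(F)):=\mathcal L_s^\Delta(F)\setminus\{\emptyset\}$, the nonempty strata ordered by reverse inclusion. In the generic case with $s\ge2$ this poset is (isomorphic to the face poset, including the empty face, of) a pure simplicial complex of dimension $n-s-1$, whose facets are the zero-dimensional strata; each of these consists of a single polynomial. A polynomial $H$ in a stratum $S$ is minimal (resp. maximal) in $S$ if its coefficient $H_{s+1}$ of $T^{n-s-1}$ is $\le$ (resp. $\ge$) the corresponding coefficient of every polynomial in $S$. The partial order $\le_p$ on $\{\Phi_1,\dots,\Phi_k\}$ is the one generated (as reflexive-transitive closure) by the relations $\{H\}=\Phi_i<_p\Phi_j=\{G\}$ whenever there is a one-dimensional stratum $R$ of $\mathcal H_s(F)$ for which $H$ is minimal and $G$ is maximal. A partial order $\le$ is finer than a partial order $\le^*$ on the same set if $a\le^*b$ implies $a\le b$. A shelling of a pure simplicial complex $C$ is an ordering $\Phi_1,\dots,\Phi_k$ of its facets such that for every $i\in\{2,\dots,k\}$ the simplicial complex $\bigcup_{j=1}^{i-1}\Phi_j\cap \Phi_i$ is pure of dimension $\dim(C)-1$ (each facet being identified with the simplex of all its faces). *)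

theory Defs
  imports "HOL-Analysis.Analysis" "HOL-Computational_Algebra.Polynomial"
begin
definition hyperbolic :: "real poly \<Rightarrow> bool" where
  "hyperbolic H \<longleftrightarrow> (\<forall>z. poly (map_poly complex_of_real H) z = 0 \<longrightarrow> z \<in> \<real>)"

definition monic_hyperbolic :: "nat \<Rightarrow> real poly set" where
  "monic_hyperbolic n = {H. degree H = n \<and> lead_coeff H = 1 \<and> hyperbolic H}"

text \<open>The coefficient of \<open>T\<^sup>n\<^sup>-\<^sup>i\<close>, written \<open>H\<^sub>i\<close> in the usual notation, is \<open>coeff H (n - i)\<close>.\<close>

definition hyp_slice :: "nat \<Rightarrow> nat \<Rightarrow> real poly \<Rightarrow> real poly set" where
  "hyp_slice n s F =
     {H \<in> monic_hyperbolic n. \<forall>i\<in>{1..s}. coeff H (n - i) = coeff F (n - i)}"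

definition generic_slice :: "nat \<Rightarrow> nat \<Rightarrow> real poly \<Rightarrow> bool" where
  "generic_slice n s F \<longleftrightarrow> \<not> (\<exists>H \<in> hyp_slice n s F. card {x. poly H x = 0} \<le> s - 1)"

definition composition :: "nat \<Rightarrow> nat list \<Rightarrow> bool" where
  "composition n c \<longleftrightarrow> (\<forall>x \<in> set c. 0 < x) \<and> sum_list c = n"

definition comp_le :: "nat list \<Rightarrow> nat list \<Rightarrow> bool" where
  "comp_le \<mu> \<nu> \<longleftrightarrow>
     (\<exists>blocks. [] \<notin> set blocks \<and> concat blocks = \<nu> \<and> map sum_list blocks = \<mu>)"

definition root_composition :: "real poly \<Rightarrow> nat list" where
  "root_composition H = map (\<lambda>a. order a H) (sorted_list_of_set {x. poly H x = 0})"

definition occurs :: "nat \<Rightarrow> nat \<Rightarrow> real poly \<Rightarrow> nat list \<Rightarrow> bool" where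
  "occurs n s F \<mu> \<longleftrightarrow> (\<exists>H \<in> hyp_slice n s F. root_composition H = \<mu>)"

definition hyp_stratum :: "nat \<Rightarrow> nat \<Rightarrow> real poly \<Rightarrow> nat list \<Rightarrow> real poly set" where
  "hyp_stratum n s F \<mu> = {H \<in> hyp_slice n s F. comp_le (root_composition H) \<mu>}"

definition strata :: "nat \<Rightarrow> nat \<Rightarrow> real poly \<Rightarrow> real poly set set" where
  "strata n s F = {hyp_stratum n s F \<mu> | \<mu>. composition n \<mu>}"

text \<open>
  The boundary complex consists of the nonempty strata, ordered by reverse inclusion
  (\<open>\<supseteq>\<close>). Its least element, which plays the role of the empty face, is the whole slice.
\<close>

definition boundary_complex :: "nat \<Rightarrow> nat \<Rightarrow> real poly \<Rightarrow> real poly set set" where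
  "boundary_complex n s F = strata n s F - {{}}"

text \<open>
  The dimension of a semialgebraic set is the largest \<open>d\<close> such that the set contains a
  homeomorphic copy of an open \<open>d\<close>-cube, equivalently of \<open>\<real>\<^sup>d\<close>. Polynomials are identified with
  their coefficient sequences; on polynomials of bounded degree the product topology
  on sequences is the Euclidean topology of the coefficient space. The empty set has no dimension
  in the sense of this predicate.
\<close>

definition has_dimension :: "real poly set \<Rightarrow> nat \<Rightarrow> bool" where
  "has_dimension S d \<longleftrightarrow>
     (let cell = (\<lambda>e. \<exists>A \<subseteq> S.
            Euclidean_space e homeomorphic_space subtopology (powertop_real UNIV) (coeff ` A))
      in cell d \<and> (\<forall>e. cell e \<longrightarrow> e \<le> d))"

text \<open>\<open>coeff H (n - s - 1)\<close> is \<open>H\<^sub>s\<^sub>+\<^sub>1\<close>. For \<open>s = n\<close>, where \<open>H\<^sub>s\<^sub>+\<^sub>1\<close> does not exist, the truncated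
  index is \<open>0\<close>; this is harmless, as the slice is then a single point.\<close>

definition minimal_in :: "nat \<Rightarrow> nat \<Rightarrow> real poly set \<Rightarrow> real poly \<Rightarrow> bool" where
  "minimal_in n s S H \<longleftrightarrow> H \<in> S \<and> (\<forall>G \<in> S. coeff H (n - s - 1) \<le> coeff G (n - s - 1))"

definition maximal_in :: "nat \<Rightarrow> nat \<Rightarrow> real poly set \<Rightarrow> real poly \<Rightarrow> bool" where
  "maximal_in n s S H \<longleftrightarrow> H \<in> S \<and> (\<forall>G \<in> S. coeff H (n - s - 1) \<ge> coeff G (n - s - 1))"

text \<open>
  In the generic case these strata are the facets of the boundary complex; this is not built into
  the definition, but \<open>shelling\<close> below requires the listed elements to be exactly the facets.
\<close>

definition slice_facets :: "nat \<Rightarrow> nat \<Rightarrow> real poly \<Rightarrow> real poly set set" where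
  "slice_facets n s F =
     {hyp_stratum n s F \<gamma> | \<gamma>. composition n \<gamma> \<and> length \<gamma> = s \<and> occurs n s F \<gamma>}"

definition order_p_gen :: "nat \<Rightarrow> nat \<Rightarrow> real poly \<Rightarrow> real poly set rel" where
  "order_p_gen n s F =
     {({H}, {G}) | H G. {H} \<in> slice_facets n s F \<and> {G} \<in> slice_facets n s F \<and>
        (\<exists>R \<in> strata n s F. has_dimension R 1 \<and> minimal_in n s R H \<and> maximal_in n s R G)}"

definition order_p :: "nat \<Rightarrow> nat \<Rightarrow> real poly \<Rightarrow> real poly set rel" where
  "order_p n s F = Restr ((order_p_gen n s F)\<^sup>*) (slice_facets n s F)"

text \<open>Abstract simplicial complexes contain the empty face, of dimension \<open>-1\<close>.\<close>

definition simplicial_complex :: "'v set set \<Rightarrow> bool" where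
  "simplicial_complex K \<longleftrightarrow>
     finite K \<and> K \<noteq> {} \<and> (\<forall>A \<in> K. finite A) \<and> (\<forall>A \<in> K. \<forall>B. B \<subseteq> A \<longrightarrow> B \<in> K)"

definition facets :: "'v set set \<Rightarrow> 'v set set" where
  "facets K = {A \<in> K. \<forall>B \<in> K. A \<subseteq> B \<longrightarrow> A = B}"

definition face_dim :: "'v set \<Rightarrow> int" where
  "face_dim A = int (card A) - 1"

definition complex_dim :: "'v set set \<Rightarrow> int" where
  "complex_dim K = Max (face_dim ` K)"

definition pure_of_dim :: "'v set set \<Rightarrow> int \<Rightarrow> bool" where
  "pure_of_dim K d \<longleftrightarrow> K \<noteq> {} \<and> (\<forall>A \<in> facets K. face_dim A = d)"

text \<open>List positions start at \<open>0\<close>, so the facet \<open>\<Phi>\<^sub>i\<close> is \<open>\<Phi>s ! (i - 1)\<close>.\<close>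

definition shelling :: "'v set set \<Rightarrow> 'v set list \<Rightarrow> bool" where
  "shelling K \<Phi>s \<longleftrightarrow>
     simplicial_complex K \<and> pure_of_dim K (complex_dim K) \<and>
     distinct \<Phi>s \<and> set \<Phi>s = facets K \<and>
     (\<forall>i. 1 \<le> i \<and> i < length \<Phi>s \<longrightarrow>
        pure_of_dim ((\<Union>j<i. Pow (\<Phi>s ! j)) \<inter> Pow (\<Phi>s ! i)) (complex_dim K - 1))"

text \<open>
  Shellings of a poset \<open>(P, le)\<close> that is isomorphic to the face poset of a simplicial complex.
  Shellings are invariant under isomorphism, so the choice of \<open>K\<close> is irrelevant, and as complexes
  are finite, the vertices may be taken to be natural numbers.
\<close>

definition poset_shelling :: "'a set \<Rightarrow> ('a \<Rightarrow> 'a \<Rightarrow> bool) \<Rightarrow> 'a list \<Rightarrow> bool" where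
  "poset_shelling P le xs \<longleftrightarrow> set xs \<subseteq> P \<and>
     (\<exists>(K :: nat set set) \<phi>. bij_betw \<phi> P K \<and>
        (\<forall>a \<in> P. \<forall>b \<in> P. le a b \<longleftrightarrow> \<phi> a \<subseteq> \<phi> b) \<and> shelling K (map \<phi> xs))"

text \<open>The total order \<open>r\<close> on \<open>X\<close> induces a shelling if listing \<open>X\<close> in \<open>r\<close>-increasing order is one.\<close>

definition induces_shelling ::
  "'a set \<Rightarrow> ('a \<Rightarrow> 'a \<Rightarrow> bool) \<Rightarrow> 'a set \<Rightarrow> 'a rel \<Rightarrow> bool" where
  "induces_shelling P le X r \<longleftrightarrow>
     (\<exists>xs. set xs = X \<and> distinct xs \<and> sorted_wrt (\<lambda>a b. (a, b) \<in> r) xs \<and>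
        poset_shelling P le xs)"

end

theory Submission
  imports Defs
    "HOL-Computational_Algebra.Fundamental_Theorem_Algebra"
    "HOL-Homology.Invariance_of_Domain"
begin

text \<open>
  A monic hyperbolic polynomial is given by the sorted vector \<open>x\<close> of its \<open>n\<close> roots, and by Newton's
  identities fixing the coefficients \<open>H\<^sub>1, \<dots>, H\<^sub>s\<close> means fixing the power sums \<open>p\<^sub>1, \<dots>, p\<^sub>s\<close>. A
  stratum prescribes a set \<open>A\<close> of ties \<open>x\<^sub>i = x\<^sub>i\<^sub>+\<^sub>1\<close>. Genericity bounds the number of ties by \<open>n - s\<close>,
  and every tie can be broken inside the slice (\<open>split_tie\<close>). Hence the nonempty strata under reverse
  inclusion are isomorphic to the tie sets of the slice under inclusion. These form a simplicial complex whose facets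
  belong to the vertices, the vectors with exactly \<open>s\<close> distinct entries.

  Everything rests on counting sign changes. If sorted vectors \<open>x \<noteq> y\<close> have equal power sums up to
  degree \<open>v\<close>, where \<open>v\<close> is the number of sign changes of \<open>y\<^sub>i - x\<^sub>i\<close>, then \<open>p\<^sub>v\<^sub>+\<^sub>1(y) - p\<^sub>v\<^sub>+\<^sub>1(x)\<close> has the
  sign of the last difference, zero counting as positive (\<open>moment_comparison\<close>). This has two consequences. First, vectors with
  \<open>m\<close> blocks are determined by \<open>m\<close> power sums; with invariance of domain this makes the
  power sums an open map on each stratum (\<open>moment_perturbation\<close>), whence ties can be broken and
  \<open>p\<^sub>s\<^sub>+\<^sub>1\<close> takes its extrema on a stratum only at vertices. Secondly, breaking a tie of a vertex \<open>x\<close>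
  increases or decreases \<open>p\<^sub>s\<^sub>+\<^sub>1\<close> according to the parity of the number of larger roots, and if all the
  ties of \<open>x\<close> that a stratum allows to be broken have the same parity, then \<open>x\<close> is the unique extremum
  of \<open>p\<^sub>s\<^sub>+\<^sub>1\<close> on the whole stratum (\<open>extremal_comparison\<close>).

  So \<open>p\<^sub>s\<^sub>+\<^sub>1\<close>, which is an affine function of \<open>H\<^sub>s\<^sub>+\<^sub>1\<close> with negative slope, behaves on the strata like a generic linear
  function on the faces of a simple polytope, and the shelling argument for polytopes applies. Let the
  vertex \<open>w\<close> come before the vertex \<open>x\<close>, and let \<open>A\<close> be the set of their common ties. If some edge at
  \<open>x\<close> inside the stratum of \<open>A\<close> leads to an earlier vertex \<open>v\<close>, then the facets of \<open>x\<close> and \<open>v\<close> share a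
  ridge containing \<open>A\<close>, as a shelling requires. Otherwise \<open>x\<close> is the unique extremum on that stratum,
  walking from \<open>w\<close> along edges towards earlier vertices can only end in \<open>x\<close>, and \<open>x\<close> would come
  before \<open>w\<close>. The reverse order is handled by the same argument with the sign of \<open>p\<^sub>s\<^sub>+\<^sub>1\<close> changed.
\<close>

section \<open>Comparing power sums of sorted vectors\<close>

definition psum :: "nat \<Rightarrow> (nat \<Rightarrow> real) \<Rightarrow> nat \<Rightarrow> real" where
  "psum n x j = (\<Sum>i<n. x i ^ j)"

lemma pderiv_sum: "pderiv (sum f A :: real poly) = (\<Sum>i\<in>A. pderiv (f i))"
  by (induction A rule: infinite_finite_induct) (auto simp: pderiv_add)

lemma ex_antiderivative_poly: "\<exists>q::real poly. pderiv q = p"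
proof
  let ?q = "\<Sum>i\<le>degree p. Polynomial.monom (Polynomial.coeff p i / real (Suc i)) (Suc i)"
  have "pderiv ?q = (\<Sum>i\<le>degree p. Polynomial.monom (Polynomial.coeff p i) i)"
    by (simp add: pderiv_sum pderiv_monom field_simps del: of_nat_Suc)
  then show "pderiv ?q = p" by (simp add: poly_as_sum_of_monoms)
qed

lemma poly_as_sum_le:
  fixes q :: "real poly"
  assumes "degree q \<le> d"
  shows "poly q t = (\<Sum>k\<le>d. Polynomial.coeff q k * t ^ k)"
  unfolding poly_altdef using assms by (intro sum.mono_neutral_left) (auto simp: coeff_eq_0)

text \<open>
  An antiderivative of a nonnegative nonzero polynomial cannot be constant on an interval, since
  a polynomial with infinitely many zeros vanishes.
\<close>

lemma poly_strict_increase: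
  fixes p q :: "real poly"
  assumes "pderiv q = p" "p \<noteq> 0" "a < b"
    and nonneg: "\<And>t. a < t \<Longrightarrow> t < b \<Longrightarrow> 0 \<le> poly p t"
  shows "poly q a < poly q b"
proof -
  have mono: "poly q u \<le> poly q w" if "a \<le> u" "u \<le> w" "w \<le> b" for u w
  proof (cases "u = w")
    case False
    then have "u < w" using that by simp
    then obtain t where t: "u < t" "t < w" "poly q w - poly q u = (w - u) * poly (pderiv q) t"
      using poly_MVT by blast
    have "0 \<le> poly p t" using nonneg t that by auto
    then have "0 \<le> (w - u) * poly (pderiv q) t" using \<open>u < w\<close> assms(1) by simp
    with t show ?thesis by linarith
  qed auto
  show ?thesis
  proof (rule ccontr)
    assume neg: "\<not> ?thesis"
    have "{a..b} \<subseteq> {t. poly (q - [:poly q a:]) t = 0}"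
    proof
      fix t assume "t \<in> {a..b}"
      then have "poly q t = poly q a"
        using mono[of a t] mono[of t b] neg by simp
      then show "t \<in> {t. poly (q - [:poly q a:]) t = 0}" by simp
    qed
    moreover have "infinite {a..b}" using \<open>a < b\<close> by (simp add: infinite_Icc)
    ultimately have "q - [:poly q a:] = 0" using poly_roots_finite finite_subset by blast
    then have "pderiv q = 0" by (metis eq_iff_diff_eq_0 pderiv_singleton)
    with assms show False by simp
  qed
qed

text \<open>
  The indices after which the sign of \<open>y\<^sub>i - x\<^sub>i\<close> changes. An entry with \<open>x\<^sub>i = y\<^sub>i\<close> fits either
  sign; counting it as nonnegative is one admissible choice.
\<close>

definition crossings :: "nat \<Rightarrow> (nat \<Rightarrow> real) \<Rightarrow> (nat \<Rightarrow> real) \<Rightarrow> nat set" where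
  "crossings n x y = {i. Suc i < n \<and> (x i \<le> y i) \<noteq> (x (Suc i) \<le> y (Suc i))}"

lemma finite_crossings [simp]: "finite (crossings n x y)"
  by (rule finite_subset[of _ "{..<n}"]) (auto simp: crossings_def)

lemma crossings_parity:
  assumes "j < n"
  shows "even (card (crossings n x y \<inter> {j..})) \<longleftrightarrow>
    ((x j \<le> y j) \<longleftrightarrow> (x (n - 1) \<le> y (n - 1)))"
proof -
  have "j \<le> n - 1" using assms by simp
  then show ?thesis
  proof (induction j rule: inc_induct)
    case base
    have "crossings n x y \<inter> {n - 1..} = {}" by (auto simp: crossings_def)
    then show ?case by simp
  next
    case (step i)
    have Si: "Suc i < n" using step by simp
    show ?case
    proof (cases "i \<in> crossings n x y")
      case True
      then have "crossings n x y \<inter> {i..} = insert i (crossings n x y \<inter> {Suc i..})"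
        by (auto simp: Suc_le_eq order_le_less)
      then have "card (crossings n x y \<inter> {i..}) = Suc (card (crossings n x y \<inter> {Suc i..}))"
        by simp
      then show ?thesis using step.IH True by (auto simp: crossings_def)
    next
      case False
      then have "crossings n x y \<inter> {i..} = crossings n x y \<inter> {Suc i..}"
        by (auto simp: Suc_le_eq order_le_less)
      then show ?thesis using step.IH False Si by (auto simp: crossings_def)
    qed
  qed
qed

text \<open>
  The intervals spanned by \<open>x\<^sub>i\<close> and \<open>y\<^sub>i\<close> move to the right with \<open>i\<close>. Where the sign changes they do
  not overlap: for \<open>x\<^sub>i \<le> y\<^sub>i\<close> and \<open>y\<^sub>i\<^sub>+\<^sub>1 < x\<^sub>i\<^sub>+\<^sub>1\<close>, say, one has \<open>y\<^sub>i \<le> y\<^sub>i\<^sub>+\<^sub>1\<close>. A zero of a polynomial can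
  therefore be put between them.
\<close>

lemma crossing_separates:
  assumes x: "mono_on {..<n} x" and y: "mono_on {..<n} y" and i: "i \<in> crossings n x y"
  shows "max (x i) (y i) \<le> min (x (Suc i)) (y (Suc i))"
proof -
  have "Suc i < n" using i by (simp add: crossings_def)
  then have "x i \<le> x (Suc i)" "y i \<le> y (Suc i)" using x y by (auto simp: mono_on_def)
  then show ?thesis using i by (auto simp: crossings_def)
qed

lemma prod_sign:
  fixes f :: "'a \<Rightarrow> real"
  assumes "finite A" "\<And>i. i \<in> A \<Longrightarrow> f i \<le> 0"
  shows "0 \<le> (- 1) ^ card A * prod f A"
  using assms
proof (induction A rule: finite_induct)
  case (insert a A)
  have "0 \<le> (- f a) * ((- 1) ^ card A * prod f A)"
    by (rule mult_nonneg_nonneg) (use insert in auto)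
  moreover have "(- 1) ^ card (insert a A) * prod f (insert a A) = (- f a) * ((- 1) ^ card A * prod f A)"
    using insert by simp
  ultimately show ?case by metis
qed auto

text \<open>
  The key inequality. Let \<open>P\<close> be a product of \<open>v\<close> linear factors, one for each crossing, with its zero
  between the two intervals that the crossing separates, and choose the sign of \<open>P\<close> such that it is
  that of \<open>y\<^sub>i - x\<^sub>i\<close> on the interval between \<open>x\<^sub>i\<close> and \<open>y\<^sub>i\<close>, for the last index and hence for all.
  If \<open>q' = P\<close>, then \<open>q(y\<^sub>i) - q(x\<^sub>i) > 0\<close> whenever \<open>x\<^sub>i \<noteq> y\<^sub>i\<close>, and so \<open>\<Sum> q(y\<^sub>i) > \<Sum> q(x\<^sub>i)\<close>. As \<open>q\<close>
  has degree \<open>v + 1\<close> and the lower power sums agree, only the power sums of degree \<open>v + 1\<close> contribute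
  to the difference, with the leading coefficient of \<open>q\<close> as factor.
\<close>

lemma moment_comparison:
  assumes x: "mono_on {..<n} x" and y: "mono_on {..<n} y"
    and v: "card (crossings n x y) = v"
    and eq: "\<And>j. 1 \<le> j \<Longrightarrow> j \<le> v \<Longrightarrow> psum n x j = psum n y j"
    and ne: "\<exists>i<n. x i \<noteq> y i"
  shows "if x (n - 1) \<le> y (n - 1) then psum n x (Suc v) < psum n y (Suc v)
         else psum n x (Suc v) > psum n y (Suc v)"
proof -
  define C where "C = crossings n x y"
  define \<epsilon> where "\<epsilon> = (if x (n - 1) \<le> y (n - 1) then 1 else - 1 :: real)"
  define P where "P = Polynomial.smult \<epsilon> (\<Prod>i\<in>C. [:- max (x i) (y i), 1:])"
  have fC: "finite C" by (simp add: C_def)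
  have e0: "\<epsilon> \<noteq> 0" by (simp add: \<epsilon>_def)
  have mon: "lead_coeff (\<Prod>i\<in>C. [:- max (x i) (y i), 1:]) = 1"
    by (simp add: lead_coeff_prod)
  have "degree (\<Prod>i\<in>C. [:- max (x i) (y i), 1:]) = v"
    using v by (subst degree_prod_sum_eq) (auto simp: C_def)
  then have degP: "degree P = v" and lP: "Polynomial.coeff P v = \<epsilon>" and P0: "P \<noteq> 0"
    using e0 mon by (auto simp: P_def)
  obtain q where q: "pderiv q = P" using ex_antiderivative_poly by blast
  have degq: "degree q \<le> Suc v" using degree_pderiv[of q] q degP by simp
  have lq: "Polynomial.coeff q (Suc v) = \<epsilon> / real (Suc v)"
    using lP unfolding q[symmetric] by (simp add: coeff_pderiv field_simps del: of_nat_Suc)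
  have polyP: "poly P t = \<epsilon> * (\<Prod>i\<in>C. t - max (x i) (y i))" for t
    by (simp add: P_def poly_prod)
  \<comment> \<open>the factors for crossings from \<open>j\<close> on vanish to the right of the \<open>j\<close>-th interval, the others to its left\<close>
  have sgnP: "0 \<le> (if x j \<le> y j then 1 else - 1) * poly P t"
    if j: "j < n" and t: "min (x j) (y j) < t" "t < max (x j) (y j)" for j t
  proof -
    let ?f = "\<lambda>i. t - max (x i) (y i)"
    have lo: "0 \<le> ?f i" if "i \<in> C \<inter> {..<j}" for i
    proof -
      have "Suc i \<le> j" "i \<in> C" using that by auto
      then have "x (Suc i) \<le> x j" "y (Suc i) \<le> y j"
        using x y j by (auto simp: mono_on_def)
      then have "max (x i) (y i) \<le> min (x j) (y j)"
        using crossing_separates[OF x y] \<open>i \<in> C\<close> unfolding C_def by (smt (verit))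
      then show ?thesis using t by (smt (verit))
    qed
    have hi: "?f i \<le> 0" if "i \<in> C \<inter> {j..}" for i
    proof -
      have "i < n" "j \<le> i" using that by (auto simp: C_def crossings_def)
      then have "x j \<le> x i" "y j \<le> y i" using x y j by (auto simp: mono_on_def)
      then show ?thesis using t by (smt (verit))
    qed
    have "C = (C \<inter> {..<j}) \<union> (C \<inter> {j..})" by auto
    then have "prod ?f C = prod ?f ((C \<inter> {..<j}) \<union> (C \<inter> {j..}))" by (rule arg_cong)
    also have "\<dots> = prod ?f (C \<inter> {..<j}) * prod ?f (C \<inter> {j..})"
      by (rule prod.union_disjoint) (simp_all add: fC disjoint_iff)
    finally have "prod ?f C = prod ?f (C \<inter> {..<j}) * prod ?f (C \<inter> {j..})" .
    moreover have "0 \<le> prod ?f (C \<inter> {..<j})" using lo by (intro prod_nonneg) auto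
    moreover have "0 \<le> (- 1) ^ card (C \<inter> {j..}) * prod ?f (C \<inter> {j..})"
      using hi fC by (intro prod_sign) auto
    ultimately have "0 \<le> (- 1) ^ card (C \<inter> {j..}) * prod ?f C"
      by (metis (no_types, lifting) mult.left_commute mult_nonneg_nonneg)
    moreover have "(- 1) ^ card (C \<inter> {j..}) = (if x j \<le> y j then 1 else - 1) * \<epsilon>"
      using crossings_parity[OF j, of x y] unfolding C_def \<epsilon>_def
      by (cases "even (card (crossings n x y \<inter> {j..}))") auto
    ultimately show ?thesis by (simp add: polyP mult.assoc)
  qed
  have incr: "poly q (x j) < poly q (y j)" if j: "j < n" "x j \<noteq> y j" for j
  proof (cases "x j < y j")
    case True
    then show ?thesis using sgnP[OF j(1)] by (intro poly_strict_increase[OF q P0]) auto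
  next
    case False
    then have "y j < x j" using j by simp
    moreover have "pderiv (- q) = - P" using q by (simp add: pderiv_minus)
    moreover have "- P \<noteq> 0" using P0 by simp
    ultimately have "poly (- q) (y j) < poly (- q) (x j)"
      using sgnP[OF j(1)] by (intro poly_strict_increase[of "- q" "- P"]) auto
    then show ?thesis by simp
  qed
  then have "(\<Sum>j<n. poly q (x j)) < (\<Sum>j<n. poly q (y j))"
  proof (intro sum_strict_mono_ex1 ballI)
    fix j assume "j \<in> {..<n}"
    then show "poly q (x j) \<le> poly q (y j)" using incr[of j] by (cases "x j = y j") auto
  qed (use ne incr in auto)
  moreover have expand: "(\<Sum>j<n. poly q (z j)) = (\<Sum>k\<le>Suc v. Polynomial.coeff q k * psum n z k)" for z
  proof -
    have "(\<Sum>j<n. poly q (z j)) = (\<Sum>j<n. \<Sum>k\<le>Suc v. Polynomial.coeff q k * z j ^ k)"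
      using degq by (intro sum.cong refl poly_as_sum_le)
    also have "\<dots> = (\<Sum>k\<le>Suc v. \<Sum>j<n. Polynomial.coeff q k * z j ^ k)" by (rule sum.swap)
    finally show ?thesis by (simp only: psum_def sum_distrib_left)
  qed
  moreover have "(\<Sum>k\<le>v. Polynomial.coeff q k * psum n x k) = (\<Sum>k\<le>v. Polynomial.coeff q k * psum n y k)"
  proof (rule sum.cong)
    fix k assume "k \<in> {..v}"
    then show "Polynomial.coeff q k * psum n x k = Polynomial.coeff q k * psum n y k"
      using eq[of k] by (cases "k = 0") (auto simp: psum_def)
  qed simp
  ultimately have "\<epsilon> / real (Suc v) * psum n x (Suc v) < \<epsilon> / real (Suc v) * psum n y (Suc v)"
    unfolding expand by (simp add: lq del: of_nat_Suc)
  then have "\<epsilon> * psum n x (Suc v) < \<epsilon> * psum n y (Suc v)"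
    by (simp add: divide_less_cancel del: of_nat_Suc)
  then show ?thesis by (simp add: \<epsilon>_def split: if_splits)
qed

text \<open>
  No crossing lies in \<open>A\<close>, so there are at most \<open>n - 1 - |A| < m\<close> crossings, and the key inequality
  contradicts the equality of the first \<open>m\<close> power sums unless the vectors agree.
\<close>

lemma psum_determines_vector:
  assumes x: "mono_on {..<n} x" and y: "mono_on {..<n} y"
    and A: "\<And>i. i \<in> A \<Longrightarrow> Suc i < n \<and> (x i \<le> y i \<longleftrightarrow> x (Suc i) \<le> y (Suc i))"
    and m: "n \<le> card A + m"
    and eq: "\<And>j. 1 \<le> j \<Longrightarrow> j \<le> m \<Longrightarrow> psum n x j = psum n y j"
    and i: "i < n"
  shows "x i = y i"
proof (rule ccontr)
  assume ne: "x i \<noteq> y i"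
  let ?C = "crossings n x y"
  have "Suc j < n" if "j \<in> A" for j using A that by blast
  then have An: "A \<subseteq> {..<n - 1}" by (force simp: less_diff_conv)
  then have "card A \<le> n - 1" using card_mono[of "{..<n - 1}" A] by simp
  note An
  moreover have "?C \<subseteq> {..<n - 1} - A" using A by (auto simp: crossings_def)
  ultimately have "card ?C \<le> card {..<n - 1} - card A"
    by (metis card_Diff_subset card_mono finite_Diff finite_lessThan finite_subset)
  then have *: "Suc (card ?C) \<le> m" using m i \<open>card A \<le> n - 1\<close> by simp
  have "psum n x (Suc (card ?C)) \<noteq> psum n y (Suc (card ?C))"
    using moment_comparison[OF x y refl] eq * ne i by (fastforce split: if_splits)
  then show False using eq * by simp
qed

definition steps :: "nat \<Rightarrow> (nat \<Rightarrow> real) \<Rightarrow> nat set" where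
  "steps n x = {i. Suc i < n \<and> x i \<noteq> x (Suc i)}"

lemma finite_steps [simp]: "finite (steps n x)"
  by (rule finite_subset[of _ "{..<n}"]) (auto simp: steps_def)

text \<open>
  A vector \<open>x\<close> with \<open>s\<close> distinct entries is the minimum or the maximum of the next power sum among
  all \<open>y\<close> that share those ties of \<open>x\<close> that have the wrong parity, the parity being that of the
  number of larger values of \<open>x\<close>. In fact, at a tie of \<open>x\<close> the difference \<open>y\<^sub>i - x\<^sub>i\<close> can only change
  from negative to nonnegative, which fixes the parity of the number of later crossings, and the
  hypothesis fixes the parity of the number of later steps of \<open>x\<close> at such a crossing. Comparing the
  two counts from the right leaves room for at most \<open>s\<close> crossings. The power sums force at least \<open>s\<close>
  crossings, so there are exactly \<open>s\<close>, and equality in the bound determines the last sign and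
  thereby the direction of the key inequality.
\<close>

lemma extremal_comparison:
  assumes x: "mono_on {..<n} x" and y: "mono_on {..<n} y"
    and s: "Suc (card (steps n x)) = s"
    and ties: "\<And>i. Suc i < n \<Longrightarrow> x i = x (Suc i) \<Longrightarrow> even (card (steps n x \<inter> {i<..})) \<noteq> e \<Longrightarrow>
        y i = y (Suc i)"
    and eq: "\<And>j. 1 \<le> j \<Longrightarrow> j \<le> s \<Longrightarrow> psum n x j = psum n y j"
    and ne: "\<exists>i<n. x i \<noteq> y i"
  shows "if e then psum n x (Suc s) < psum n y (Suc s) else psum n x (Suc s) > psum n y (Suc s)"
proof -
  define C where "C = crossings n x y"
  define v where "v = card C"
  define N where "N i = card (steps n x \<inter> {i<..})" for i
  define R where "R i = card (C \<inter> {i<..})" for i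
  define d :: nat where "d = (if (x (n - 1) \<le> y (n - 1)) = e then 0 else 1)"
  have fC: "finite C" by (simp add: C_def)
  \<comment> \<open>\<open>R\<close> and \<open>N\<close> count the later crossings and the later steps; \<open>d\<close> is \<open>0\<close> if the last sign is the desired one\<close>
  have tie: "even (R c + N c + d)" if c: "c \<in> C" "c \<notin> steps n x" for c
  proof -
    have Sc: "Suc c < n" "x c = x (Suc c)" "(x c \<le> y c) \<noteq> (x (Suc c) \<le> y (Suc c))"
      using c by (auto simp: C_def crossings_def steps_def)
    have "y c \<le> y (Suc c)" using y Sc by (auto simp: mono_on_def)
    then have up: "x (Suc c) \<le> y (Suc c)" using Sc by auto
    have "even (N c) = e"
    proof (rule ccontr)
      assume "even (N c) \<noteq> e"
      then have "y c = y (Suc c)" using ties[of c] Sc unfolding N_def by blast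
      then show False using Sc by simp
    qed
    moreover have "{c<..} = {Suc c..}" by auto
    then have "even (R c) = (x (n - 1) \<le> y (n - 1))"
      using crossings_parity[of "Suc c" n x y] Sc up by (simp add: R_def C_def)
    ultimately show ?thesis by (auto simp: d_def)
  qed
  \<comment> \<open>going downwards, a crossing at a step uses up a step, and at a tie parity improves the bound by one\<close>
  have bound: "R c + d \<le> Suc (N c)" if "c \<in> C" for c
    using that
  proof (induction "n - c" arbitrary: c rule: less_induct)
    case less
    let ?D = "C \<inter> {c<..}"
    show ?case
    proof (cases "?D = {}")
      case True
      then show ?thesis by (simp add: R_def d_def)
    next
      case False
      define c' where "c' = Min ?D"
      have c': "c' \<in> C" "c < c'" using Min_in[of ?D] False fC by (auto simp: c'_def)
      have "c' \<le> z" if "z \<in> ?D" for z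
        using Min_le[of ?D z] that fC by (simp add: c'_def)
      then have "?D = insert c' (C \<inter> {c'<..})" using c' by force
      then have R: "R c = Suc (R c')" using fC by (simp add: R_def)
      have "c' < n" using c' by (auto simp: C_def crossings_def)
      then have IH: "R c' + d \<le> Suc (N c')" using less.hyps[of c'] c' by auto
      show ?thesis
      proof (cases "c' \<in> steps n x")
        case True
        then have "insert c' (steps n x \<inter> {c'<..}) \<subseteq> steps n x \<inter> {c<..}" using c' by auto
        then have "card (insert c' (steps n x \<inter> {c'<..})) \<le> N c"
          unfolding N_def by (intro card_mono) auto
        then have "Suc (N c') \<le> N c" by (simp add: N_def)
        then show ?thesis using IH R by simp
      next
        case False
        have "N c' \<le> N c" unfolding N_def using c' by (intro card_mono) auto
        moreover have "R c' + d \<le> N c'" using IH tie[OF c'(1) False] by presburger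
        ultimately show ?thesis using R by simp
      qed
    qed
  qed
  have comp: "if x (n - 1) \<le> y (n - 1) then psum n x (Suc v) < psum n y (Suc v)
         else psum n x (Suc v) > psum n y (Suc v)" if "v \<le> s"
    using that eq ne by (intro moment_comparison[OF x y]) (auto simp: v_def C_def)
  have "s \<le> v"
  proof (rule ccontr)
    assume "\<not> s \<le> v"
    then show False using comp eq[of "Suc v"] by (simp split: if_splits)
  qed
  then have "C \<noteq> {}" using s by (auto simp: v_def)
  define c where "c = Min C"
  have c: "c \<in> C" using \<open>C \<noteq> {}\<close> fC by (simp add: c_def)
  have "c \<le> z" if "z \<in> C" for z using Min_le[of C z] that fC by (simp add: c_def)
  then have "C = insert c (C \<inter> {c<..})" using c by force
  then have vR: "v = Suc (R c)"
    unfolding v_def R_def using fC by (metis (no_types) card_insert_disjoint finite_Int IntE greaterThan_iff less_irrefl)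
  have "v + d \<le> s"
  proof (cases "c \<in> steps n x")
    case True
    then have "insert c (steps n x \<inter> {c<..}) \<subseteq> steps n x" by auto
    then have "card (insert c (steps n x \<inter> {c<..})) \<le> card (steps n x)" by (intro card_mono) auto
    then have "Suc (N c) \<le> card (steps n x)" by (simp add: N_def)
    then show ?thesis using bound[OF c] vR s by simp
  next
    case False
    have "N c \<le> card (steps n x)" unfolding N_def by (intro card_mono) auto
    moreover have "R c + d \<le> N c" using bound[OF c] tie[OF c False] by presburger
    ultimately show ?thesis using vR s by simp
  qed
  then have "v = s" "d = 0" using \<open>s \<le> v\<close> by auto
  then show ?thesis using comp by (simp add: d_def split: if_splits)
qed

section \<open>Polynomials and their root vectors\<close>

definition root_poly :: "nat \<Rightarrow> (nat \<Rightarrow> real) \<Rightarrow> real poly" where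
  "root_poly n x = (\<Prod>i<n. [:- x i, 1:])"

lemma root_poly_0 [simp]: "root_poly 0 x = 1"
  and root_poly_Suc: "root_poly (Suc n) x = root_poly n x * [:- x n, 1:]"
  by (simp_all add: root_poly_def)

lemma degree_root_poly [simp]: "degree (root_poly n x) = n"
  unfolding root_poly_def by (subst degree_prod_sum_eq) auto

lemma lead_coeff_root_poly [simp]: "Polynomial.coeff (root_poly n x) n = 1"
proof -
  have "lead_coeff (root_poly n x) = 1" unfolding root_poly_def lead_coeff_prod by simp
  then show ?thesis by simp
qed

lemma root_poly_nonzero [simp]: "root_poly n x \<noteq> 0"
  by (metis lead_coeff_root_poly coeff_0 zero_neq_one)

lemma poly_root_poly: "poly (root_poly n x) t = 0 \<longleftrightarrow> (\<exists>i<n. t = x i)"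
  by (auto simp: root_poly_def poly_prod)

lemma order_root_poly: "Polynomial.order a (root_poly n x) = card {i. i < n \<and> x i = a}"
proof (induction n)
  case (Suc n)
  have "Polynomial.order a (root_poly (Suc n) x) = Polynomial.order a (root_poly n x) + Polynomial.order a [:- x n, 1:]"
    using root_poly_nonzero[of "Suc n" x] unfolding root_poly_Suc by (rule Polynomial.order_mult)
  also have "Polynomial.order a [:- x n, 1:] = (if x n = a then 1 else 0)"
    using order_power_n_n[of a 1] by (auto simp: order_0I)
  also have "Polynomial.order a (root_poly n x) + \<dots> = card {i. i < Suc n \<and> x i = a}"
  proof (cases "x n = a")
    case True
    then have "{i. i < Suc n \<and> x i = a} = insert n {i. i < n \<and> x i = a}" by auto
    then show ?thesis using Suc True by simp
  next
    case False
    then have "{i. i < Suc n \<and> x i = a} = {i. i < n \<and> x i = a}" by (auto simp: less_Suc_eq)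
    then show ?thesis using Suc False by simp
  qed
  finally show ?case .
qed (simp add: order_1_eq_0)

text \<open>
  Newton's identities. Synthetic division gives the coefficients of \<open>B\<^sub>i = H / (T - x\<^sub>i)\<close> as
  \<open>\<Sum>l\<le>k. H\<^sub>l x\<^sub>i\<^sup>k\<^sup>-\<^sup>l\<close>; summing over \<open>i\<close> and comparing with \<open>H' = \<Sum> B\<^sub>i\<close> yields all identities
  with \<open>j < n\<close>. For \<open>j = n\<close> one sums \<open>H(x\<^sub>i) = 0\<close> instead.
\<close>

lemma newton_identity:
  assumes "j \<le> n"
  shows "real j * Polynomial.coeff (root_poly n x) (n - j) =
     - (\<Sum>l<j. Polynomial.coeff (root_poly n x) (n - l) * psum n x (j - l))"
proof (cases "j = 0")
  case False
  define H where "H = root_poly n x"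
  define B where "B i = (\<Prod>k\<in>{..<n} - {i}. [:- x k, 1:])" for i
  have HB: "H = [:- x i, 1:] * B i" if "i < n" for i
    unfolding H_def root_poly_def B_def using that by (subst prod.remove[of _ i]) auto
  have degB: "degree (B i) = n - 1" if "i < n" for i
    unfolding B_def using that by (subst degree_prod_sum_eq) auto
  have cB: "Polynomial.coeff (B i) (n - 1 - k) = (\<Sum>l\<le>k. Polynomial.coeff H (n - l) * x i ^ (k - l))"
    if "i < n" "k < n" for i k
    using that(2)
  proof (induction k)
    case 0
    have "Polynomial.coeff H n = Polynomial.coeff (B i) (n - 1)"
      unfolding HB[OF that(1)] using that degB[OF that(1)]
      by (cases n) (auto simp: coeff_eq_0)
    then show ?case by simp
  next
    case (Suc k)
    have e: "n - Suc k = Suc (n - 1 - Suc k)" "n - 1 - k = Suc (n - 1 - Suc k)" using Suc.prems by auto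
    have "Polynomial.coeff H (n - Suc k) = Polynomial.coeff (B i) (n - 1 - Suc k) - x i * Polynomial.coeff (B i) (n - 1 - k)"
      unfolding HB[OF that(1)] by (subst e(1), subst e(2)) simp
    then have "Polynomial.coeff (B i) (n - 1 - Suc k) = Polynomial.coeff H (n - Suc k) + x i * Polynomial.coeff (B i) (n - 1 - k)"
      by simp
    also have "x i * Polynomial.coeff (B i) (n - 1 - k) = (\<Sum>l\<le>k. Polynomial.coeff H (n - l) * x i ^ (Suc k - l))"
      using Suc by (auto simp: sum_distrib_left Suc_diff_le intro!: sum.cong)
    finally show ?case by simp
  qed
  have "pderiv H = (\<Sum>i<n. B i)"
    unfolding H_def root_poly_def B_def pderiv_prod by (simp add: pderiv_pCons)
  then have "Polynomial.coeff (pderiv H) (n - 1 - j) = (\<Sum>i<n. Polynomial.coeff (B i) (n - 1 - j))"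
    by (simp add: coeff_sum)
  show ?thesis
  proof (cases "j = n")
    case True
    have "0 = (\<Sum>i<n. poly H (x i))"
      unfolding H_def by (intro sum.neutral[symmetric]) (auto simp: poly_root_poly)
    also have "\<dots> = (\<Sum>i<n. \<Sum>l\<le>n. Polynomial.coeff H l * x i ^ l)"
      by (intro sum.cong refl poly_as_sum_le) (simp add: H_def)
    also have "\<dots> = (\<Sum>i<n. \<Sum>l\<le>n. Polynomial.coeff H (n - l) * x i ^ (n - l))"
      by (intro sum.cong refl sum.reindex_bij_witness[of _ "\<lambda>l. n - l" "\<lambda>l. n - l"]) auto
    also have "\<dots> = (\<Sum>l\<le>n. Polynomial.coeff H (n - l) * psum n x (n - l))"
      by (subst sum.swap) (simp add: psum_def sum_distrib_left)
    also have "\<dots> = (\<Sum>l<n. Polynomial.coeff H (n - l) * psum n x (n - l)) + Polynomial.coeff H 0 * n"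
      by (simp add: lessThan_Suc_atMost[symmetric] psum_def)
    finally show ?thesis using True by (simp add: H_def add_eq_0_iff algebra_simps)
  next
    case jn: False
    then have jn: "j < n" using assms by simp
    have "real (n - j) * Polynomial.coeff H (n - j) = Polynomial.coeff (pderiv H) (n - 1 - j)"
      using jn by (simp add: coeff_pderiv Suc_diff_Suc del: of_nat_Suc)
    also have "\<dots> = (\<Sum>i<n. \<Sum>l\<le>j. Polynomial.coeff H (n - l) * x i ^ (j - l))"
      using \<open>Polynomial.coeff (pderiv H) (n - 1 - j) = _\<close> cB jn by simp
    also have "\<dots> = (\<Sum>l\<le>j. Polynomial.coeff H (n - l) * psum n x (j - l))"
      by (subst sum.swap) (simp add: psum_def sum_distrib_left)
    also have "\<dots> = (\<Sum>l<j. Polynomial.coeff H (n - l) * psum n x (j - l)) + Polynomial.coeff H (n - j) * n"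
      by (simp add: lessThan_Suc_atMost[symmetric] psum_def)
    finally show ?thesis using jn by (simp add: H_def of_nat_diff algebra_simps)
  qed
qed simp

lemma coeffs_eq_iff_psums_eq:
  assumes "s \<le> n"
  shows "(\<forall>j\<in>{1..s}. Polynomial.coeff (root_poly n x) (n - j) = Polynomial.coeff (root_poly n y) (n - j)) \<longleftrightarrow>
    (\<forall>j\<in>{1..s}. psum n x j = psum n y j)"
  using assms
proof (induction s)
  case (Suc s)
  let ?X = "\<lambda>j. Polynomial.coeff (root_poly n x) (n - j)" and ?Y = "\<lambda>j. Polynomial.coeff (root_poly n y) (n - j)"
  have split: "{1..Suc s} = insert (Suc s) {1..s}" by auto
  have step: "(?X (Suc s) = ?Y (Suc s)) = (psum n x (Suc s) = psum n y (Suc s))"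
    if c: "\<forall>j\<in>{1..s}. ?X j = ?Y j" and p: "\<forall>j\<in>{1..s}. psum n x j = psum n y j"
  proof -
    have X: "real (Suc s) * ?X (Suc s) = - psum n x (Suc s) - (\<Sum>l\<in>{1..s}. ?X l * psum n x (Suc s - l))"
      and Y: "real (Suc s) * ?Y (Suc s) = - psum n y (Suc s) - (\<Sum>l\<in>{1..s}. ?Y l * psum n y (Suc s - l))"
      using newton_identity[OF Suc.prems, of x] newton_identity[OF Suc.prems, of y]
      by (simp_all add: lessThan_Suc_atMost atMost_atLeast0 sum.atLeast_Suc_atMost del: of_nat_Suc)
    have "(\<Sum>l\<in>{1..s}. ?X l * psum n x (Suc s - l)) = (\<Sum>l\<in>{1..s}. ?Y l * psum n y (Suc s - l))"
    proof (rule sum.cong)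
      fix l assume "l \<in> {1..s}"
      moreover from this have "Suc s - l \<in> {1..s}" by auto
      ultimately show "?X l * psum n x (Suc s - l) = ?Y l * psum n y (Suc s - l)"
        using c p by metis
    qed simp
    then have "real (Suc s) * ?X (Suc s) = real (Suc s) * ?Y (Suc s) \<longleftrightarrow> psum n x (Suc s) = psum n y (Suc s)"
      using X Y by linarith
    then show ?thesis by (simp del: of_nat_Suc)
  qed
  show ?case using Suc step unfolding split by simp blast
qed simp

text \<open>
  When the first \<open>s\<close> coefficients agree, the next coefficient is an affine function of the next power
  sum with negative slope: minimizing one is maximizing the other.
\<close>

lemma next_coeff_diff:
  assumes "s < n" "\<forall>j\<in>{1..s}. psum n x j = psum n y j"
  shows "real (Suc s) * (Polynomial.coeff (root_poly n x) (n - Suc s) - Polynomial.coeff (root_poly n y) (n - Suc s)) =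
    psum n y (Suc s) - psum n x (Suc s)"
proof -
  let ?X = "\<lambda>j. Polynomial.coeff (root_poly n x) (n - j)" and ?Y = "\<lambda>j. Polynomial.coeff (root_poly n y) (n - j)"
  have c: "\<forall>j\<in>{1..s}. ?X j = ?Y j" using coeffs_eq_iff_psums_eq[of s n x y] assms by simp
  have X: "real (Suc s) * ?X (Suc s) = - psum n x (Suc s) - (\<Sum>l\<in>{1..s}. ?X l * psum n x (Suc s - l))"
    and Y: "real (Suc s) * ?Y (Suc s) = - psum n y (Suc s) - (\<Sum>l\<in>{1..s}. ?Y l * psum n y (Suc s - l))"
    using newton_identity[of "Suc s" n x] newton_identity[of "Suc s" n y] assms
    by (simp_all add: lessThan_Suc_atMost atMost_atLeast0 sum.atLeast_Suc_atMost del: of_nat_Suc)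
  have "(\<Sum>l\<in>{1..s}. ?X l * psum n x (Suc s - l)) = (\<Sum>l\<in>{1..s}. ?Y l * psum n y (Suc s - l))"
  proof (rule sum.cong)
    fix l assume "l \<in> {1..s}"
    moreover from this have "Suc s - l \<in> {1..s}" by auto
    ultimately show "?X l * psum n x (Suc s - l) = ?Y l * psum n y (Suc s - l)"
      using c assms(2) by metis
  qed simp
  then show ?thesis using X Y by (simp add: right_diff_distrib del: of_nat_Suc)
qed

text \<open>
  Entries beyond the first \<open>n\<close> are set to zero, so that equality of vectors is equality of functions
  and the vectors live in the Euclidean space inside the sequence space.
\<close>

definition root_vectors :: "nat \<Rightarrow> (nat \<Rightarrow> real) set" where
  "root_vectors n = {x. mono_on {..<n} x \<and> (\<forall>i\<ge>n. x i = 0)}"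

lemma inj_on_root_poly: "inj_on (root_poly n) (root_vectors n)"
proof (intro inj_onI ext)
  fix x y i assume x: "x \<in> root_vectors n" and y: "y \<in> root_vectors n"
    and eq: "root_poly n x = root_poly n y"
  then have "\<forall>j\<in>{1..n}. psum n x j = psum n y j"
    using coeffs_eq_iff_psums_eq[of n n x y] by simp
  then show "x i = y i"
    using psum_determines_vector[of n x y "{}" n i] x y
    by (cases "i < n") (auto simp: root_vectors_def)
qed

lemma map_poly_of_real_mult:
  "map_poly complex_of_real (p * q) = map_poly complex_of_real p * map_poly complex_of_real q"
  by (rule poly_eqI) (simp add: coeff_map_poly coeff_mult)

lemma poly_map_poly_of_real:
  "poly (map_poly complex_of_real p) (complex_of_real a) = complex_of_real (poly p a)"
  by (induction p) (auto simp: map_poly_pCons)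

lemma hyperbolic_root_poly: "hyperbolic (root_poly n x)"
proof -
  have "map_poly complex_of_real (root_poly n x) = (\<Prod>i<n. [:- complex_of_real (x i), 1:])"
    by (induction n) (auto simp: root_poly_Suc map_poly_pCons map_poly_of_real_mult
        simp del: mult_pCons_right)
  then show ?thesis by (auto simp: hyperbolic_def poly_prod)
qed

lemma hyperbolic_splits:
  assumes "hyperbolic H" "lead_coeff H = 1" "degree H = n"
  shows "\<exists>x. H = root_poly n x"
  using assms
proof (induction n arbitrary: H)
  case 0
  then show ?case by (metis root_poly_0 degree_0_id lead_coeff_pCons(1) one_pCons degree_eq_zeroE)
next
  case (Suc n)
  have "degree (map_poly complex_of_real H) = Suc n" using Suc.prems by (simp add: degree_map_poly)
  then obtain z where z: "poly (map_poly complex_of_real H) z = 0"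
    using fundamental_theorem_of_algebra[of "map_poly complex_of_real H"]
    by (metis constant_degree nat.distinct(1))
  then obtain a where a: "z = complex_of_real a"
    using Suc.prems by (metis hyperbolic_def Reals_cases)
  then have "poly H a = 0" using z by (simp add: poly_map_poly_of_real)
  then obtain G where G: "H = [:- a, 1:] * G" by (metis dvdE poly_eq_0_iff_dvd)
  have G0: "G \<noteq> 0" using G Suc.prems by auto
  have "hyperbolic G"
    using Suc.prems(1) unfolding G hyperbolic_def map_poly_of_real_mult by simp
  moreover have "lead_coeff G = 1" using Suc.prems(2) unfolding G lead_coeff_mult by simp
  moreover have "degree G = n"
    using Suc.prems(3) degree_mult_eq[of "[:- a, 1:]" G] G0 unfolding G[symmetric] by simp
  ultimately obtain x where x: "G = root_poly n x" using Suc.IH by blast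
  have "H = root_poly (Suc n) (x(n := a))"
    unfolding G x root_poly_def by (simp add: mult.commute)
  then show ?case by blast
qed

lemma root_poly_perm:
  "\<exists>y\<in>root_vectors n. root_poly n y = root_poly n x"
proof -
  let ?l = "map x [0..<n]"
  define y where "y i = (if i < n then sort ?l ! i else 0)" for i
  have "y \<in> root_vectors n"
    by (auto simp: root_vectors_def y_def mono_on_def sorted_nth_mono)
  moreover have "root_poly n z = (\<Prod>a\<in>#mset (map z [0..<n]). [:- a, 1:])" for z
    by (induction n) (auto simp: root_poly_Suc mult.commute)
  moreover have "map y [0..<n] = sort ?l"
    by (rule nth_equalityI) (auto simp: y_def)
  ultimately show ?thesis by (metis mset_sort)
qed

lemma monic_hyperbolic_eq: "monic_hyperbolic n = root_poly n ` root_vectors n"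
proof (intro equalityI subsetI)
  fix H assume "H \<in> monic_hyperbolic n"
  then obtain x where "H = root_poly n x" using hyperbolic_splits by (auto simp: monic_hyperbolic_def)
  then show "H \<in> root_poly n ` root_vectors n" using root_poly_perm by (metis image_eqI)
qed (auto simp: monic_hyperbolic_def hyperbolic_root_poly)

section \<open>Openness of the moment map\<close>

lemma openin_Euclidean_space_box:
  assumes "openin (Euclidean_space N) U" "p \<in> U"
  obtains e where "e > 0" "\<And>q. (\<And>i. i \<ge> N \<Longrightarrow> q i = 0) \<Longrightarrow> (\<And>i. i < N \<Longrightarrow> \<bar>q i - p i\<bar> < e) \<Longrightarrow> q \<in> U"
proof -
  obtain V where V: "openin (powertop_real UNIV) V" "U = V \<inter> {x. \<forall>i\<ge>N. x i = 0}"
    using assms(1) unfolding Euclidean_space_def openin_subtopology by blast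
  have "p \<in> V" using assms(2) V(2) by simp
  have "\<exists>W. finite {i \<in> UNIV. W i \<noteq> topspace euclideanreal} \<and>
      (\<forall>i\<in>UNIV. openin euclideanreal (W i)) \<and> p \<in> Pi\<^sub>E UNIV W \<and> Pi\<^sub>E UNIV W \<subseteq> V"
    using iffD1[OF openin_product_topology_alt V(1)] \<open>p \<in> V\<close> by (rule bspec)
  then obtain W where W: "\<forall>i\<in>UNIV. openin euclideanreal (W i)" "p \<in> Pi\<^sub>E UNIV W"
      "Pi\<^sub>E UNIV W \<subseteq> V"
    by (elim exE conjE)
  have "\<exists>e>0. \<forall>z. \<bar>z - p i\<bar> < e \<longrightarrow> z \<in> W i" for i
  proof -
    have "open (W i)" "p i \<in> W i" using W(1,2) by (simp_all add: PiE_iff)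
    then show ?thesis unfolding open_dist by (auto simp: dist_real_def)
  qed
  then obtain e where e: "\<And>i. e i > 0" "\<And>i z. \<bar>z - p i\<bar> < e i \<Longrightarrow> z \<in> W i" by metis
  define r where "r = Min (insert 1 (e ` {..<N}))"
  have "r > 0" using e(1) by (auto simp: r_def)
  moreover have "q \<in> U" if "\<And>i. i \<ge> N \<Longrightarrow> q i = 0" "\<And>i. i < N \<Longrightarrow> \<bar>q i - p i\<bar> < r" for q
  proof -
    have "q i \<in> W i" for i
    proof (cases "i < N")
      case True
      then have "r \<le> e i" unfolding r_def by (intro Min_le) auto
      then show ?thesis using that(2)[OF True] e(2)[of "q i" i] by simp
    next
      case False
      have "p i = 0" using assms(2) V(2) False by auto
      then show ?thesis using that(1)[of i] False e(1)[of i] e(2)[of "q i" i] by simp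
    qed
    then have "q \<in> V" using W(3) by (auto simp: PiE_iff)
    then show ?thesis using V(2) that(1) by auto
  qed
  ultimately show thesis using that by blast
qed

lemma continuous_map_Euclidean_coordinate:
  "continuous_map (Euclidean_space N) euclideanreal (\<lambda>w. w i)"
  unfolding Euclidean_space_def
  by (intro continuous_map_from_subtopology continuous_map_product_projection) simp

lemma openin_Euclidean_cube:
  "openin (Euclidean_space N) {w \<in> topspace (Euclidean_space N). \<forall>i<k. \<bar>w i\<bar> < r}"
proof (induction k)
  case (Suc k)
  let ?E = "Euclidean_space N"
  have "openin ?E {w \<in> topspace ?E. w k \<in> {- r<..<r}}"
    by (rule openin_continuous_map_preimage[OF continuous_map_Euclidean_coordinate]) auto
  then have "openin ?E ({w \<in> topspace ?E. w k \<in> {- r<..<r}} \<inter> {w \<in> topspace ?E. \<forall>i<k. \<bar>w i\<bar> < r})"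
    using Suc by (rule openin_Int)
  also have "{w \<in> topspace ?E. w k \<in> {- r<..<r}} \<inter> {w \<in> topspace ?E. \<forall>i<k. \<bar>w i\<bar> < r} =
     {w \<in> topspace ?E. \<forall>i<Suc k. \<bar>w i\<bar> < r}"
    by (auto simp: less_Suc_eq abs_less_iff)
  finally show ?case .
qed simp

lemma mono_on_lessThanI:
  fixes f :: "nat \<Rightarrow> real"
  assumes "\<And>i. Suc i < n \<Longrightarrow> f i \<le> f (Suc i)"
  shows "mono_on {..<n} f"
proof (rule mono_onI)
  fix i j assume "i \<in> {..<n}" "j \<in> {..<n}" "i \<le> j"
  from \<open>i \<le> j\<close> \<open>j \<in> {..<n}\<close> show "f i \<le> f j"
  proof (induction j rule: dec_induct)
    case (step k)
    then show ?case using assms[of k] by auto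
  qed simp
qed

text \<open>
  Near \<open>x\<close> the power sums up to degree \<open>d\<close> take all nearby values, even after moving \<open>x\<close> a little in
  the monotone direction \<open>g\<close>. Cut the index range after the \<open>d - 1\<close> positions in \<open>D\<close>, where \<open>x\<close>
  increases strictly, and shift each of the \<open>d\<close> resulting segments rigidly by its own amount. For
  equal \<open>t\<close>, two such vectors differ by a function that is constant on the segments, so they are
  told apart by the first \<open>d\<close> power sums. Hence the map sending the shifts and \<open>t\<close> to the power sums and
  \<open>t\<close> is injective, and invariance of domain makes it open. Using \<open>\<bar>t\<bar>\<close> makes the map available
  on a full neighbourhood of \<open>t = 0\<close>. Small shifts keep the steps of \<open>x\<close> and create only the steps
  of \<open>g\<close>.
\<close>

lemma moment_perturbation:
  assumes x: "mono_on {..<n} x" and g: "mono_on {..<n} g"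
    and n: "0 < n" and D: "D \<subseteq> steps n x" "Suc (card D) = d"
  obtains \<eta> where "\<eta> > 0"
    "\<And>t c. \<bar>t\<bar> < \<eta> \<Longrightarrow> (\<And>j. j \<in> {1..d} \<Longrightarrow> \<bar>c j\<bar> < \<eta>) \<Longrightarrow>
       \<exists>y. mono_on {..<n} y \<and> (\<forall>i\<ge>n. y i = 0) \<and> (\<forall>j\<in>{1..d}. psum n y j = psum n x j + c j) \<and>
         steps n y = steps n x \<union> (if t = 0 then {} else steps n g)"
proof -
  \<comment> \<open>the segment that contains \<open>i\<close>\<close>
  define b where "b i = card (D \<inter> {..<i})" for i
  have fD: "finite D" using D finite_steps finite_subset by blast
  have Dn: "Suc i < n" if "i \<in> D" for i using that D by (auto simp: steps_def)
  have bS: "b (Suc i) = (if i \<in> D then Suc (b i) else b i)" for i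
    using fD by (auto simp: b_def lessThan_Suc)
  have bd: "b i < d" for i
    using card_mono[OF fD, of "D \<inter> {..<i}"] D by (simp add: b_def)
  have b_onto: "\<exists>i<n. b i = k" if "k < d" "0 < n" for k
  proof -
    have "\<exists>i\<le>m. b i = k" if "k \<le> b m" for m
      using that
    proof (induction m)
      case (Suc m)
      then show ?case by (cases "k \<le> b m") (auto simp: bS split: if_splits intro: le_SucI)
    qed (auto simp: b_def)
    moreover have "D \<inter> {..<n - 1} = D" using Dn by force
    then have "k \<le> b (n - 1)" using \<open>k < d\<close> D by (simp add: b_def)
    ultimately show ?thesis using \<open>0 < n\<close> by (metis Suc_pred' le_imp_less_Suc)
  qed
  \<comment> \<open>coordinate \<open>0\<close> of \<open>w\<close> is the parameter \<open>t\<close>, coordinate \<open>k + 1\<close> the shift of the \<open>k\<close>-th segment\<close>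
  define y where "y w i = (x i + w (Suc (b i)) + \<bar>w 0\<bar> * g i :: real)" for w i
  have y_diff: "y w (Suc i) - y w i = x (Suc i) - x i +
      (if i \<in> D then w (Suc (Suc (b i))) - w (Suc (b i)) else 0) + \<bar>w 0\<bar> * (g (Suc i) - g i)"
    for w i by (simp add: y_def bS algebra_simps)
  have gS: "g i \<le> g (Suc i)" and xS: "x i \<le> x (Suc i)" if "Suc i < n" for i
    using g x that by (auto simp: mono_on_def)
  \<comment> \<open>a radius that keeps apart all neighbouring values separated in \<open>x\<close>\<close>
  define r where "r = Min (insert 1 ((\<lambda>i. (x (Suc i) - x i) / 2) ` steps n x))"
  have r: "r > 0"
  proof -
    have "x i < x (Suc i)" if "i \<in> steps n x" for i using xS[of i] that by (auto simp: steps_def)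
    then show ?thesis by (auto simp: r_def)
  qed
  have gap: "2 * r \<le> x (Suc i) - x i" if "i \<in> steps n x" for i
  proof -
    have "r \<le> (x (Suc i) - x i) / 2" unfolding r_def using that by (intro Min_le) auto
    then show ?thesis by simp
  qed
  have pos: "y w i < y w (Suc i)"
    if "i \<in> steps n x" "\<And>k. k < Suc d \<Longrightarrow> \<bar>w k\<bar> < r" for w i
  proof -
    have i: "Suc i < n" using that(1) by (simp add: steps_def)
    have "0 \<le> \<bar>w 0\<bar> * (g (Suc i) - g i)" using gS[OF i] by simp
    moreover have "\<bar>w (Suc (b i))\<bar> < r" using that(2) bd[of i] by simp
    moreover have "\<bar>w (Suc (b (Suc i)))\<bar> < r" using that(2) bd[of "Suc i"] by simp
    ultimately show ?thesis
      using y_diff[of w i] gap[OF that(1)] r bS[of i] by (cases "i \<in> D") auto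
  qed
  have tie: "y w (Suc i) - y w i = \<bar>w 0\<bar> * (g (Suc i) - g i)" if "i \<notin> steps n x" "Suc i < n" for w i
    using y_diff[of w i] D that by (auto simp: steps_def)
  have mono: "mono_on {..<n} (y w)" if "\<And>k. k < Suc d \<Longrightarrow> \<bar>w k\<bar> < r" for w
  proof (rule mono_on_lessThanI)
    fix i assume i: "Suc i < n"
    have "0 \<le> \<bar>w 0\<bar> * (g (Suc i) - g i)" using gS[OF i] by simp
    then show "y w i \<le> y w (Suc i)"
      using pos[of i w] that tie[of i w] i by (cases "i \<in> steps n x") auto
  qed
  have steps_y: "steps n (y w) = steps n x \<union> (if w 0 = 0 then {} else steps n g)"
    if "\<And>k. k < Suc d \<Longrightarrow> \<bar>w k\<bar> < r" for w
  proof -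
    have "i \<in> steps n (y w) \<longleftrightarrow> i \<in> steps n x \<union> (if w 0 = 0 then {} else steps n g)"
      if i: "Suc i < n" for i
    proof (cases "i \<in> steps n x")
      case True
      then show ?thesis using pos[OF True, of w] \<open>\<And>k. k < Suc d \<Longrightarrow> \<bar>w k\<bar> < r\<close> i
        by (auto simp: steps_def)
    next
      case False
      then show ?thesis using tie[OF False i, of w] i gS[OF i] by (auto simp: steps_def)
    qed
    note iff = this
    show ?thesis
    proof (rule Set.set_eqI)
      fix i
      show "i \<in> steps n (y w) \<longleftrightarrow> i \<in> steps n x \<union> (if w 0 = 0 then {} else steps n g)"
      proof (cases "Suc i < n")
        case False
        then show ?thesis by (auto simp: steps_def)
      qed (rule iff)
    qed
  qed
  let ?E = "Euclidean_space (Suc d)"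
  define U where "U = {w \<in> topspace ?E. \<forall>i<Suc d. \<bar>w i\<bar> < r}"
  define G where "G w = (\<lambda>j. if j < Suc d then (if j = 0 then w 0 else psum n (y w) j) else 0)" for w
  have "openin ?E (G ` U)"
  proof (rule invariance_of_domain_Euclidean_space)
    show "openin ?E U" unfolding U_def by (rule openin_Euclidean_cube)
    have "continuous_map ?E euclideanreal (\<lambda>w. if j = 0 then w 0 else psum n (y w) j)" for j
      unfolding psum_def y_def
      by (cases "j = 0") (auto intro!: continuous_intros continuous_map_Euclidean_coordinate
          continuous_map_sum continuous_map_real_abs)
    then have "continuous_map ?E ?E G"
      unfolding G_def by (subst continuous_map_componentwise_Euclidean_space) auto
    then show "continuous_map (subtopology ?E U) ?E G" by (rule continuous_map_from_subtopology)
    show "inj_on G U"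
    proof (rule inj_onI)
      fix w w' assume w: "w \<in> U" "w' \<in> U" and eq: "G w = G w'"
      have eqj: "G w j = G w' j" for j using eq by simp
      have t: "w 0 = w' 0" using eqj[of 0] by (simp add: G_def)
      have m: "psum n (y w) j = psum n (y w') j" if "1 \<le> j" "j \<le> d" for j
        using eqj[of j] that by (simp add: G_def)
      let ?A = "{..<n - 1} - D"
      have eqy: "y w i = y w' i" if "i < n" for i
      proof (rule psum_determines_vector[where A = ?A and m = d, OF mono mono _ _ m that])
        show "n \<le> card ?A + d"
        proof -
          have "D \<subseteq> {..<n - 1}" using Dn by force
          then show ?thesis using card_Diff_subset[OF fD, of "{..<n - 1}"] D that
              card_mono[of "{..<n - 1}" D] by simp
        qed
      next
        fix i assume "i \<in> ?A"
        then show "Suc i < n \<and> (y w i \<le> y w' i) = (y w (Suc i) \<le> y w' (Suc i))"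
          using t by (auto simp: y_def bS)
      qed (use w in \<open>auto simp: U_def\<close>)
      show "w = w'"
      proof
        fix k
        consider "k = 0" | "k \<ge> Suc d" | k' where "k = Suc k'" "k' < d" by (cases k) (auto, linarith)
        then show "w k = w' k"
        proof cases
          case 3
          then obtain i where "i < n" "b i = k'" using b_onto n by blast
          then show ?thesis using eqy[of i] t 3 by (simp add: y_def)
        qed (use t w in \<open>auto simp: U_def topspace_Euclidean_space\<close>)
      qed
    qed
  qed
  moreover have "(\<lambda>_. 0) \<in> U" using r by (simp add: U_def topspace_Euclidean_space)
  then have "G (\<lambda>_. 0) \<in> G ` U" by blast
  ultimately obtain \<eta> where \<eta>: "\<eta> > 0" "\<And>q. (\<And>i. i \<ge> Suc d \<Longrightarrow> q i = 0) \<Longrightarrow>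
      (\<And>i. i < Suc d \<Longrightarrow> \<bar>q i - G (\<lambda>_. 0) i\<bar> < \<eta>) \<Longrightarrow> q \<in> G ` U"
    using openin_Euclidean_space_box by blast
  have "\<exists>z. mono_on {..<n} z \<and> (\<forall>i\<ge>n. z i = 0) \<and> (\<forall>j\<in>{1..d}. psum n z j = psum n x j + c j) \<and>
         steps n z = steps n x \<union> (if t = 0 then {} else steps n g)"
    if t: "\<bar>t\<bar> < \<eta>" and c: "\<And>j. j \<in> {1..d} \<Longrightarrow> \<bar>c j\<bar> < \<eta>" for t c
  proof -
    have y0: "y (\<lambda>_. 0) = x" by (simp add: y_def fun_eq_iff)
    define q where "q j = (if j < Suc d then (if j = 0 then t else psum n x j + c j) else 0)" for j
    have "q \<in> G ` U"
      by (rule \<eta>(2)) (use t c in \<open>auto simp: q_def G_def y0\<close>)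
    then obtain w where w: "w \<in> U" "G w = q" by auto
    have eqj: "G w j = q j" for j using w by simp
    have w0: "w 0 = t" using eqj[of 0] by (simp add: G_def q_def)
    have wr: "\<And>k. k < Suc d \<Longrightarrow> \<bar>w k\<bar> < r" using w by (simp add: U_def)
    let ?z = "\<lambda>i. if i < n then y w i else 0"
    have "psum n ?z j = psum n x j + c j" if "j \<in> {1..d}" for j
      using eqj[of j] that by (simp add: G_def q_def psum_def)
    moreover have "mono_on {..<n} ?z" using mono[OF wr] by (auto simp: mono_on_def)
    moreover have "steps n ?z = steps n (y w)" by (auto simp: steps_def)
    ultimately show ?thesis using steps_y[OF wr] w0 by (intro exI[of _ ?z]) auto
  qed
  with \<eta>(1) show thesis by (rule that)
qed

section \<open>Faces and vertices of a generic slice\<close>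

definition ties :: "nat \<Rightarrow> (nat \<Rightarrow> real) \<Rightarrow> nat set" where
  "ties n x = {i. Suc i < n \<and> x i = x (Suc i)}"

lemma ties_eq: "ties n x = {..<n - 1} - steps n x"
  by (auto simp: ties_def steps_def)

lemma finite_ties [simp]: "finite (ties n x)"
  by (simp add: ties_eq)

lemma card_ties_steps: "card (ties n x) + card (steps n x) = n - 1"
proof -
  have "card (ties n x \<union> steps n x) = card (ties n x) + card (steps n x)"
    using finite_ties[of n x] finite_steps[of n x]
    by (intro card_Un_disjoint) (auto simp: ties_def steps_def)
  moreover have "ties n x \<union> steps n x = {..<n - 1}" by (auto simp: ties_def steps_def)
  ultimately show ?thesis by simp
qed

definition moment_slice :: "nat \<Rightarrow> nat \<Rightarrow> (nat \<Rightarrow> real) \<Rightarrow> (nat \<Rightarrow> real) set" where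
  "moment_slice n s c = {x \<in> root_vectors n. \<forall>j\<in>{1..s}. psum n x j = c j}"

lemma continuous_on_psum: "continuous_on S (\<lambda>x. psum n x j)"
  unfolding psum_def
  by (intro continuous_on_sum continuous_on_power continuous_on_subset[OF continuous_on_product_coordinates])
    simp

text \<open>
  The second power sum bounds all entries, and this is where \<open>s \<ge> 2\<close> is essential.
\<close>

lemma compact_moment_slice:
  assumes "2 \<le> s"
  shows "compact {x \<in> moment_slice n s c. A \<subseteq> ties n x}"
proof -
  define M where "M = c 2 + 1"
  let ?P = "PiE UNIV (\<lambda>i. if i < n then {- M..M} else {0}) :: (nat \<Rightarrow> real) set"
  let ?S = "{x \<in> moment_slice n s c. A \<subseteq> ties n x}"
  have "compactin (product_topology (\<lambda>i. euclidean) UNIV) ?P"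
    unfolding compactin_PiE by auto
  then have P: "compact ?P" unfolding euclidean_product_topology by simp
  have "x \<in> ?P" if "x \<in> ?S" for x
  proof -
    have x: "\<forall>i\<ge>n. x i = 0" "psum n x 2 = c 2"
      using that assms by (auto simp: moment_slice_def root_vectors_def)
    have "x i \<in> {- M..M}" if "i < n" for i
    proof -
      have "(x i)\<^sup>2 \<le> psum n x 2"
        unfolding psum_def by (rule member_le_sum) (use that in auto)
      moreover have "2 * \<bar>x i\<bar> \<le> (x i)\<^sup>2 + 1"
        using sum_squares_ge_zero[of "\<bar>x i\<bar> - 1" 0]
        by (simp add: algebra_simps power2_eq_square abs_mult_self_eq)
      moreover have "0 \<le> (x i)\<^sup>2" by simp
      ultimately have "\<bar>x i\<bar> \<le> M" using x(2) unfolding M_def by linarith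
      then show ?thesis by (simp add: abs_le_iff)
    qed
    then show ?thesis using x by (auto simp: PiE_iff)
  qed
  then have sub: "?S \<subseteq> ?P" by blast
  have co: "continuous_on UNIV (\<lambda>x :: nat \<Rightarrow> real. x i)" for i by simp
  have S: "?S = (\<Inter>i\<in>{..<n}. \<Inter>j\<in>{i..<n}. {x. x i \<le> x j}) \<inter> (\<Inter>i\<in>{n..}. {x. x i = 0}) \<inter>
      (\<Inter>j\<in>{1..s}. {x. psum n x j = c j}) \<inter> (\<Inter>i\<in>A. {x. Suc i < n \<and> x i = x (Suc i)})"
    by (auto simp: moment_slice_def root_vectors_def ties_def mono_on_def subset_iff)
  have "closed {x :: nat \<Rightarrow> real. Suc i < n \<and> x i = x (Suc i)}" for i
    by (intro closed_Collect_conj closed_Collect_const closed_Collect_eq co)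
  then have "closed ?S"
    unfolding S by (intro closed_Int closed_INT ballI closed_Collect_le closed_Collect_eq co
        continuous_on_const continuous_on_psum)
  then show ?thesis using P sub compact_Int_closed[of ?P ?S] by (simp add: Int_absorb1)
qed

text \<open>
  The slice in terms of roots. A vector with \<open>k\<close> steps has \<open>k + 1\<close> distinct entries, so the last
  condition is genericity.
\<close>

locale generic_moment_slice =
  fixes n s :: nat and c :: "nat \<Rightarrow> real"
  assumes s2: "2 \<le> s" and sn: "s \<le> n"
    and generic: "\<And>x. x \<in> moment_slice n s c \<Longrightarrow> s \<le> Suc (card (steps n x))"
begin

abbreviation X :: "(nat \<Rightarrow> real) set" where "X \<equiv> moment_slice n s c"

definition face :: "nat set \<Rightarrow> (nat \<Rightarrow> real) set" where
  "face A = {x \<in> X. A \<subseteq> ties n x}"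

text \<open>
  Vectors with exactly \<open>s\<close> distinct entries, the smallest number possible.
\<close>

definition vertices :: "(nat \<Rightarrow> real) set" where
  "vertices = {x \<in> X. card (ties n x) = n - s}"

lemma vertices_card_steps: "x \<in> vertices \<Longrightarrow> Suc (card (steps n x)) = s"
  using card_ties_steps[of n x] s2 sn by (simp add: vertices_def)

lemma verticesI: "x \<in> X \<Longrightarrow> card (steps n x) < s \<Longrightarrow> x \<in> vertices"
  using card_ties_steps[of n x] s2 sn generic[of x] by (simp add: vertices_def)

lemma X_D: "x \<in> X \<Longrightarrow> mono_on {..<n} x" "x \<in> X \<Longrightarrow> i \<ge> n \<Longrightarrow> x i = 0"
  "x \<in> X \<Longrightarrow> 1 \<le> j \<Longrightarrow> j \<le> s \<Longrightarrow> psum n x j = c j"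
  by (auto simp: moment_slice_def root_vectors_def)

lemma X_eqI:
  assumes "x \<in> X" "y \<in> X" "A \<subseteq> ties n x" "A \<subseteq> ties n y" "n \<le> card A + m"
    "\<And>j. s < j \<Longrightarrow> j \<le> m \<Longrightarrow> psum n x j = psum n y j"
  shows "x = y"
proof
  fix i
  show "x i = y i"
  proof (cases "i < n")
    case True
    show ?thesis
    proof (rule psum_determines_vector[OF X_D(1)[OF assms(1)] X_D(1)[OF assms(2)] _ assms(5) _ True])
      fix k assume "k \<in> A"
      then show "Suc k < n \<and> (x k \<le> y k) = (x (Suc k) \<le> y (Suc k))"
        using subsetD[OF assms(3)] subsetD[OF assms(4)] by (simp add: ties_def)
    next
      fix j assume "1 \<le> j" "j \<le> m"
      then show "psum n x j = psum n y j"
        using assms(6)[of j] X_D(3)[OF assms(1), of j] X_D(3)[OF assms(2), of j] by (cases "j \<le> s") auto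
    qed
  next
    case False
    then show ?thesis using X_D(2)[OF assms(1), of i] X_D(2)[OF assms(2), of i] by simp
  qed
qed

lemma vertex_eqI:
  assumes "x \<in> vertices" "y \<in> X" "ties n x \<subseteq> ties n y"
  shows "y = x"
  using X_eqI[of y x "ties n x" s] assms sn by (auto simp: vertices_def)

lemma finite_vertices: "finite vertices"
proof (rule finite_imageD)
  show "finite (ties n ` vertices)"
    by (rule finite_subset[of _ "Pow {..<n}"]) (auto simp: ties_def)
  show "inj_on (ties n) vertices"
    using vertex_eqI by (intro inj_onI) (auto simp: vertices_def)
qed

text \<open>
  A single tie can be broken within the slice: push all later entries up a little and correct the
  power sums by shifting \<open>s\<close> segments. Genericity provides enough steps to cut at.
\<close>

lemma split_tie:
  assumes x: "x \<in> X" and i: "i \<in> ties n x"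
  obtains y where "y \<in> X" "ties n y = ties n x - {i}"
proof -
  let ?g = "\<lambda>k. if i < k then 1 else 0 :: real"
  have "s - 1 \<le> card (steps n x)" using generic[OF x] by simp
  then obtain D where D: "D \<subseteq> steps n x" "card D = s - 1" by (meson obtain_subset_with_card_n)
  have g: "mono_on {..<n} ?g" by (auto simp: mono_on_def)
  obtain \<eta> where \<eta>: "\<eta> > 0" "\<And>t c. \<bar>t\<bar> < \<eta> \<Longrightarrow> (\<And>j. j \<in> {1..s} \<Longrightarrow> \<bar>c j\<bar> < \<eta>) \<Longrightarrow>
       \<exists>y. mono_on {..<n} y \<and> (\<forall>i\<ge>n. y i = 0) \<and> (\<forall>j\<in>{1..s}. psum n y j = psum n x j + c j) \<and>
         steps n y = steps n x \<union> (if t = 0 then {} else steps n ?g)"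
    using moment_perturbation[OF X_D(1)[OF x] g _ D(1), of s] s2 sn D by auto
  obtain y where y: "mono_on {..<n} y" "\<forall>i\<ge>n. y i = 0" "\<forall>j\<in>{1..s}. psum n y j = psum n x j"
    "steps n y = steps n x \<union> steps n ?g"
    using \<eta>(2)[of "\<eta> / 2" "\<lambda>_. 0"] \<eta>(1) by auto
  have "y \<in> X" using y X_D(3)[OF x] by (auto simp: moment_slice_def root_vectors_def)
  moreover have "steps n ?g = {i}" using i by (auto simp: steps_def ties_def less_Suc_eq)
  then have "ties n y = ties n x - {i}" using y(4) by (auto simp: ties_eq)
  ultimately show thesis using that by blast
qed

text \<open>
  Breaking superfluous ties one by one reaches a vector whose ties are exactly \<open>A\<close>; hence different
  sets \<open>A\<close> give different nonempty faces.
\<close>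

lemma face_generic_point:
  assumes "face A \<noteq> {}"
  obtains x where "x \<in> X" "ties n x = A"
proof -
  obtain x where x: "x \<in> face A" and min: "\<And>y. y \<in> face A \<Longrightarrow> card (ties n x) \<le> card (ties n y)"
    using assms ex_has_least_nat[of "\<lambda>x. x \<in> face A" _ "\<lambda>x. card (ties n x)"] by blast
  have "ties n x \<subseteq> A"
  proof
    fix i assume i: "i \<in> ties n x"
    show "i \<in> A"
    proof (rule ccontr)
      assume "i \<notin> A"
      obtain y where y: "y \<in> X" "ties n y = ties n x - {i}"
        using split_tie[of x i] x i by (auto simp: face_def)
      have "y \<in> face A" using y x \<open>i \<notin> A\<close> by (auto simp: face_def)
      moreover have "card (ties n y) < card (ties n x)"
        unfolding y(2) using i by (intro card_Diff1_less) auto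
      ultimately show False using min by fastforce
    qed
  qed
  then show thesis using x that by (auto simp: face_def)
qed

text \<open>
  With more than \<open>s\<close> distinct entries there is room for one more power sum to vary freely.
\<close>

lemma no_local_extremum:
  assumes x: "x \<in> X" "s \<le> card (steps n x)"
  obtains \<eta> where "\<eta> > 0" "\<And>z. \<bar>z\<bar> < \<eta> \<Longrightarrow>
    \<exists>y\<in>X. ties n y = ties n x \<and> psum n y (Suc s) = psum n x (Suc s) + z"
proof -
  obtain D where D: "D \<subseteq> steps n x" "card D = s" using x by (meson obtain_subset_with_card_n)
  have g: "mono_on {..<n} (\<lambda>_. 0 :: real)" by (auto simp: mono_on_def)
  obtain \<eta> where \<eta>: "\<eta> > 0" "\<And>t c. \<bar>t\<bar> < \<eta> \<Longrightarrow> (\<And>j. j \<in> {1..Suc s} \<Longrightarrow> \<bar>c j\<bar> < \<eta>) \<Longrightarrow>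
       \<exists>y. mono_on {..<n} y \<and> (\<forall>i\<ge>n. y i = 0) \<and> (\<forall>j\<in>{1..Suc s}. psum n y j = psum n x j + c j) \<and>
         steps n y = steps n x \<union> (if t = 0 then {} else steps n (\<lambda>_. 0))"
    using moment_perturbation[OF X_D(1)[OF x(1)] g _ D(1), of "Suc s"] s2 sn D by auto
  have "\<exists>y\<in>X. ties n y = ties n x \<and> psum n y (Suc s) = psum n x (Suc s) + z" if z: "\<bar>z\<bar> < \<eta>" for z
  proof -
    have "\<exists>y. mono_on {..<n} y \<and> (\<forall>i\<ge>n. y i = 0) \<and>
       (\<forall>j\<in>{1..Suc s}. psum n y j = psum n x j + (if j = Suc s then z else 0)) \<and>
       steps n y = steps n x"
      using \<eta>(2)[of 0 "\<lambda>j. if j = Suc s then z else 0"] \<eta>(1) z by simp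
    then obtain y where y: "mono_on {..<n} y" "\<forall>i\<ge>n. y i = 0" "steps n y = steps n x"
       "\<forall>j\<in>{1..Suc s}. psum n y j = psum n x j + (if j = Suc s then z else 0)" by blast
    have "psum n y j = c j" if "j \<in> {1..s}" for j
      using y(4)[rule_format, of j] X_D(3)[OF x(1), of j] that by auto
    then have "y \<in> X" using y by (auto simp: moment_slice_def root_vectors_def)
    moreover have "psum n y (Suc s) = psum n x (Suc s) + z" using y(4) by simp
    ultimately show ?thesis using y(3) by (auto simp: ties_eq)
  qed
  with \<eta>(1) show thesis by (rule that)
qed

text \<open>
  The sign lets one argument treat minima and maxima, and thus an order and its reverse, together.
\<close>

definition height :: "bool \<Rightarrow> (nat \<Rightarrow> real) \<Rightarrow> real" where
  "height e x = (if e then psum n x (Suc s) else - psum n x (Suc s))"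

lemma height_attains_max:
  assumes "face A \<noteq> {}"
  obtains w where "w \<in> face A" "w \<in> vertices" "\<And>y. y \<in> face A \<Longrightarrow> height e y \<le> height e w"
proof -
  have "continuous_on (face A) (height e)"
    unfolding height_def by (cases e) (auto intro!: continuous_on_psum continuous_on_minus)
  moreover have "compact (face A)" unfolding face_def by (rule compact_moment_slice[OF s2])
  ultimately obtain w where w: "w \<in> face A" "\<And>y. y \<in> face A \<Longrightarrow> height e y \<le> height e w"
    using continuous_attains_sup assms by metis
  have "w \<in> vertices"
  proof (rule ccontr)
    assume "w \<notin> vertices"
    then have "s \<le> card (steps n w)" using verticesI[of w] w by (force simp: face_def)
    then obtain \<eta> where \<eta>: "\<eta> > 0" "\<And>z. \<bar>z\<bar> < \<eta> \<Longrightarrow>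
      \<exists>y\<in>X. ties n y = ties n w \<and> psum n y (Suc s) = psum n w (Suc s) + z"
      using no_local_extremum[of w] w by (auto simp: face_def)
    have "\<bar>if e then \<eta> / 2 else - \<eta> / 2\<bar> < \<eta>" using \<eta>(1) by simp
    from \<eta>(2)[OF this] obtain y where y: "y \<in> X" "ties n y = ties n w"
      "psum n y (Suc s) = psum n w (Suc s) + (if e then \<eta> / 2 else - \<eta> / 2)" by blast
    then have "y \<in> face A" using w by (auto simp: face_def)
    then have "height e y \<le> height e w" using w by blast
    then show False using y(3) \<eta>(1) by (simp add: height_def split: if_splits)
  qed
  with w show thesis using that by blast
qed

definition steps_above :: "(nat \<Rightarrow> real) \<Rightarrow> nat \<Rightarrow> nat" where
  "steps_above x i = card (steps n x \<inter> {i<..})"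

text \<open>
  The ties of \<open>x\<close> outside \<open>A\<close> are those along which one can leave \<open>x\<close> inside the face. When each of
  them, taken alone, leads upwards, \<open>x\<close> is not merely a local but the unique minimum.
\<close>

lemma vertex_strict_min:
  assumes x: "x \<in> vertices" and A: "A \<subseteq> ties n x"
    and par: "\<And>i. i \<in> ties n x - A \<Longrightarrow> even (steps_above x i) = e"
    and y: "y \<in> face A" "y \<noteq> x"
  shows "height e x < height e y"
proof -
  have X: "x \<in> X" "y \<in> X" using x y by (auto simp: vertices_def face_def)
  have ne: "\<exists>i<n. x i \<noteq> y i"
  proof (rule ccontr)
    assume "\<not> ?thesis"
    then have "x i = y i" for i using X_D(2)[OF X(1), of i] X_D(2)[OF X(2), of i] by (cases "i < n") auto
    then show False using y(2) by auto
  qed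
  have "if e then psum n x (Suc s) < psum n y (Suc s) else psum n x (Suc s) > psum n y (Suc s)"
  proof (rule extremal_comparison[OF X_D(1)[OF X(1)] X_D(1)[OF X(2)] vertices_card_steps[OF x] _ _ ne])
    fix i assume i: "Suc i < n" "x i = x (Suc i)" "even (card (steps n x \<inter> {i<..})) \<noteq> e"
    then have "i \<in> A" using par[of i] by (auto simp: ties_def steps_above_def)
    then show "y i = y (Suc i)" using y(1) by (auto simp: face_def ties_def)
  next
    fix j assume "1 \<le> j" "j \<le> s"
    then show "psum n x j = psum n y j" using X_D(3)[OF X(1)] X_D(3)[OF X(2)] by simp
  qed
  then show ?thesis by (simp add: height_def split: if_splits)
qed

text \<open>
  Pairs consisting of the top and the bottom vertex of a one-dimensional face. For \<open>e = True\<close>, the top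
  has the smallest coefficient \<open>H\<^sub>s\<^sub>+\<^sub>1\<close>, so these are the generating relations of \<open>\<le>\<^sub>p\<close>.
\<close>

definition edge :: "bool \<Rightarrow> ((nat \<Rightarrow> real) \<times> (nat \<Rightarrow> real)) set" where
  "edge e = {(u, v). u \<in> vertices \<and> v \<in> vertices \<and> (\<exists>B. Suc (card B) = n - s \<and>
     u \<in> face B \<and> v \<in> face B \<and>
     (\<forall>y\<in>face B. height e v \<le> height e y \<and> height e y \<le> height e u))}"

text \<open>
  Releasing one tie of a vertex gives a one-dimensional face of which \<open>x\<close> is the bottom if the parity
  fits. The face contains more than \<open>x\<close>, and its maximum is again attained at a vertex.
\<close>

lemma other_end_of_edge:
  assumes x: "x \<in> vertices" and i: "i \<in> ties n x"
    and e: "even (steps_above x i) = e"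
  obtains w where "(w, x) \<in> edge e" "ties n x \<inter> ties n w = ties n x - {i}"
    "height e x < height e w"
proof -
  let ?B = "ties n x - {i}"
  have xX: "x \<in> X" and card: "card (ties n x) = n - s" using x by (auto simp: vertices_def)
  have xB: "x \<in> face ?B" using xX by (auto simp: face_def)
  then obtain w where w: "w \<in> face ?B" "w \<in> vertices" "\<And>y. y \<in> face ?B \<Longrightarrow> height e y \<le> height e w"
    using height_attains_max by (metis empty_iff)
  obtain z where z: "z \<in> X" "ties n z = ?B" using split_tie[OF xX i] by blast
  have low: "height e x < height e y" if "y \<in> face ?B" "y \<noteq> x" for y
    using vertex_strict_min[OF x, of ?B e y] that i e by auto
  have "z \<noteq> x" using z i by auto
  then have "height e x < height e z" using low z by (auto simp: face_def)
  also have "\<dots> \<le> height e w" using w(3) z by (auto simp: face_def)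
  finally have xw: "height e x < height e w" .
  have "i \<notin> ties n w"
  proof
    assume "i \<in> ties n w"
    then have "ties n x \<subseteq> ties n w" using w(1) by (auto simp: face_def)
    then have "w = x" using vertex_eqI[OF x] w(1) by (auto simp: face_def)
    then show False using xw by simp
  qed
  then have "ties n x \<inter> ties n w = ?B" using w(1) by (auto simp: face_def)
  moreover have "Suc (card ?B) = n - s" using i card by (metis card_Suc_Diff1 finite_ties)
  then have "(w, x) \<in> edge e"
    unfolding edge_def using w x xB low by (auto intro!: exI[of _ ?B] simp: order_le_less)
  ultimately show thesis using that xw by blast
qed

text \<open>
  If no edge of the face leads upwards from \<open>x\<close>, then \<open>x\<close> is its unique top, and climbing along edges
  from any other vertex \<open>w\<close> of the face can only end in \<open>x\<close>.
\<close>

lemma path_from_top: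
  assumes x: "x \<in> vertices" "A \<subseteq> ties n x"
    and par: "\<And>i. i \<in> ties n x - A \<Longrightarrow> even (steps_above x i) \<noteq> e"
    and w: "w \<in> vertices" "w \<in> face A"
  shows "(x, w) \<in> (edge e)\<^sup>*"
  using w
proof (induction "card {v \<in> vertices. height e w < height e v}" arbitrary: w rule: less_induct)
  case less
  show ?case
  proof (cases "w = x")
    case False
    have "\<exists>i\<in>ties n w - A. even (steps_above w i) = e"
    proof (rule ccontr)
      assume "\<not> ?thesis"
      then have "height (\<not> e) w < height (\<not> e) x"
        using vertex_strict_min[of w A "\<not> e" x] less.prems x False by (auto simp: face_def vertices_def)
      moreover have "height (\<not> e) x < height (\<not> e) w"
        using vertex_strict_min[of x A "\<not> e" w] less.prems x False par by auto
      ultimately show False by simp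
    qed
    then obtain i where i: "i \<in> ties n w" "i \<notin> A" "even (steps_above w i) = e" by blast
    obtain v where v: "(v, w) \<in> edge e" "ties n w \<inter> ties n v = ties n w - {i}"
      "height e w < height e v"
      using other_end_of_edge[OF less.prems(1) i(1,3)] by blast
    have vV: "v \<in> vertices" using v(1) by (auto simp: edge_def)
    have "v \<in> face A" using v(2) i(2) less.prems vV by (auto simp: face_def vertices_def)
    moreover have "card {u \<in> vertices. height e v < height e u} < card {u \<in> vertices. height e w < height e u}"
      using v(3) vV finite_vertices by (intro psubset_card_mono) (auto simp: psubset_eq)
    ultimately have "(x, v) \<in> (edge e)\<^sup>*" using less.hyps vV by blast
    then show ?thesis using v(1) by (rule rtrancl_into_rtrancl)
  qed simp
qed

text \<open>
  Inside the face of the common ties of \<open>x\<close> and \<open>w\<close>, either some edge leads upwards from \<open>x\<close>, and its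
  other end \<open>v\<close> is as wanted, or \<open>x\<close> is the top of that face and lies above \<open>w\<close>.
\<close>

lemma shelling_step:
  assumes x: "x \<in> vertices" and w: "w \<in> vertices" and nle: "(x, w) \<notin> (edge e)\<^sup>*"
  obtains v where "(v, x) \<in> edge e" "ties n x \<inter> ties n w \<subseteq> ties n v"
    "v \<noteq> x" "Suc (card (ties n x \<inter> ties n v)) = n - s"
proof -
  let ?A = "ties n x \<inter> ties n w"
  have "\<exists>i\<in>ties n x - ?A. even (steps_above x i) = e"
  proof (rule ccontr)
    assume "\<not> ?thesis"
    then have "(x, w) \<in> (edge e)\<^sup>*"
      using w by (intro path_from_top[OF x, of ?A]) (auto simp: face_def vertices_def)
    then show False using nle by simp
  qed
  then obtain i where i: "i \<in> ties n x" "i \<notin> ?A" "even (steps_above x i) = e" by blast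
  obtain v where v: "(v, x) \<in> edge e" "ties n x \<inter> ties n v = ties n x - {i}"
      "height e x < height e v"
    using other_end_of_edge[OF x i(1,3)] by blast
  have "Suc (card (ties n x - {i})) = n - s"
    using i x by (metis (mono_tags, lifting) card_Suc_Diff1 finite_ties mem_Collect_eq vertices_def)
  then show thesis using v i by (intro that[OF v(1)]) auto
qed

lemma edge_flip: "(u, v) \<in> edge (\<not> e) \<longleftrightarrow> (v, u) \<in> edge e"
  by (auto simp: edge_def height_def split: if_splits)

end

section \<open>The dimension of edges\<close>

text \<open>
  Padding an injective continuous real function on \<open>\<real>\<^sup>e\<close> with zeros would, for \<open>e \<ge> 2\<close>, contradict
  invariance of domain, as its image contains no point off the first axis.
\<close>

lemma cell_dim_le_1:
  assumes hom: "Euclidean_space e homeomorphic_space X"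
    and cont: "continuous_map X euclideanreal h" and inj: "inj_on h (topspace X)"
  shows "e \<le> 1"
proof (rule ccontr)
  assume "\<not> e \<le> 1"
  then have e: "2 \<le> e" by simp
  let ?E = "Euclidean_space e"
  obtain f g where "homeomorphic_maps ?E X f g"
    using hom by (auto simp: homeomorphic_space_def)
  then have f: "continuous_map ?E X f" "\<And>w. w \<in> topspace ?E \<Longrightarrow> g (f w) = w"
    by (auto simp: homeomorphic_maps_def)
  define G where "G w = (\<lambda>i. if i < e then (if i = 0 then h (f w) else 0) else 0)" for w
  have c: "continuous_map ?E euclideanreal (\<lambda>w. h (f w))"
    using continuous_map_compose[OF f(1) cont] by (simp add: comp_def)
  then have "continuous_map ?E ?E G"
    unfolding G_def continuous_map_componentwise_Euclidean_space by auto
  moreover have "inj_on G (topspace ?E)"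
  proof (rule inj_onI)
    fix u v assume uv: "u \<in> topspace ?E" "v \<in> topspace ?E" "G u = G v"
    then have "G u 0 = G v 0" by simp
    then have "h (f u) = h (f v)" using e by (simp add: G_def)
    moreover have "f u \<in> topspace X" "f v \<in> topspace X"
      using f(1) uv by (auto simp: continuous_map_def)
    ultimately have "f u = f v" using inj by (auto dest: inj_onD)
    then show "u = v" using f(2) uv by metis
  qed
  ultimately have op: "openin ?E (G ` topspace ?E)"
    by (intro invariance_of_domain_Euclidean_space) auto
  have z: "(\<lambda>_. 0) \<in> topspace ?E" by (simp add: topspace_Euclidean_space)
  then have "G (\<lambda>_. 0) \<in> G ` topspace ?E" by blast
  then obtain \<epsilon> where eps: "\<epsilon> > 0" "\<And>q. (\<And>i. i \<ge> e \<Longrightarrow> q i = 0) \<Longrightarrow>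
      (\<And>i. i < e \<Longrightarrow> \<bar>q i - G (\<lambda>_. 0) i\<bar> < \<epsilon>) \<Longrightarrow> q \<in> G ` topspace ?E"
    using openin_Euclidean_space_box[OF op] by metis
  define q where "q = (G (\<lambda>_. 0))(1 := \<epsilon> / 2)"
  have "q \<in> G ` topspace ?E"
    by (rule eps(2)) (use e eps(1) in \<open>auto simp: q_def G_def\<close>)
  then obtain w where "q = G w" by blast
  then have "q 1 = G w 1" by simp
  then show False using eps(1) by (simp add: q_def G_def split: if_splits)
qed

lemma Euclidean_space_1: "Euclidean_space 1 homeomorphic_space euclideanreal"
proof -
  have "homeomorphic_maps (Euclidean_space 1) euclideanreal (\<lambda>w. w 0) (\<lambda>t i. if i < 1 then t else 0)"
    unfolding homeomorphic_maps_def
  proof (intro conjI ballI)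
    show "continuous_map euclideanreal (Euclidean_space 1) (\<lambda>t i. if i < 1 then t else 0)"
      unfolding continuous_map_componentwise_Euclidean_space by simp
  qed (auto simp: continuous_map_Euclidean_coordinate topspace_Euclidean_space fun_eq_iff)
  then show ?thesis unfolding homeomorphic_space_def by blast
qed

lemma continuous_on_coeff_root_poly: "continuous_on UNIV (\<lambda>x. Polynomial.coeff (root_poly n x))"
proof -
  have "continuous_on UNIV (\<lambda>x. Polynomial.coeff (root_poly n x) k)" for k
  proof (induction n arbitrary: k)
    case (Suc n)
    have co: "continuous_on UNIV (\<lambda>x :: nat \<Rightarrow> real. x n)" by simp
    have "Polynomial.coeff (root_poly (Suc n) x) k =
        (if k = 0 then 0 else Polynomial.coeff (root_poly n x) (k - 1)) - x n * Polynomial.coeff (root_poly n x) k" for x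
      by (cases k) (auto simp: root_poly_Suc)
    moreover have "continuous_on UNIV (\<lambda>x. (if k = 0 then 0 else Polynomial.coeff (root_poly n x) (k - 1)) -
        x n * Polynomial.coeff (root_poly n x) k)"
      by (cases "k = 0") (auto intro!: continuous_on_diff continuous_on_mult continuous_on_minus Suc co)
    ultimately show ?case by simp
  qed simp
  then show ?thesis by (intro continuous_on_coordinatewise_then_product)
qed

context generic_moment_slice
begin

text \<open>
  On a face with \<open>s + 1\<close> blocks the power sums up to degree \<open>s + 1\<close> determine the vector, so the
  coefficient \<open>H\<^sub>s\<^sub>+\<^sub>1\<close> is injective on the compact stratum and embeds it into the real line. At a
  vector with \<open>s + 1\<close> distinct entries this coefficient varies freely, so the image contains an
  interval.
\<close>

lemma edge_has_dimension_1:
  assumes B: "Suc (card B) = n - s" "face B \<noteq> {}"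
  shows "has_dimension (root_poly n ` face B) 1"
proof -
  let ?co = "\<lambda>x. Polynomial.coeff (root_poly n x)"
  let ?\<pi> = "\<lambda>q :: nat \<Rightarrow> real. q (n - Suc s)"
  let ?Q = "?co ` face B"
  have ns: "s < n" using B by simp
  have "compact ?Q"
    unfolding face_def
    by (intro compact_continuous_image compact_moment_slice[OF s2]
        continuous_on_subset[OF continuous_on_coeff_root_poly]) auto
  moreover have co\<pi>: "continuous_on ?Q ?\<pi>"
    by (rule continuous_on_subset[OF continuous_on_product_coordinates]) simp
  moreover have inj: "inj_on ?\<pi> ?Q"
  proof (rule inj_onI)
    fix p q assume "p \<in> ?Q" "q \<in> ?Q" and eq: "?\<pi> p = ?\<pi> q"
    then obtain x y where xy: "x \<in> face B" "y \<in> face B" "p = ?co x" "q = ?co y" by blast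
    have X: "x \<in> X" "y \<in> X" "B \<subseteq> ties n x" "B \<subseteq> ties n y" using xy by (auto simp: face_def)
    have "psum n x (Suc s) = psum n y (Suc s)"
      using next_coeff_diff[OF ns, of x y] X_D(3)[OF X(1)] X_D(3)[OF X(2)] eq xy(3,4) by simp
    then have "psum n x j = psum n y j" if "s < j" "j \<le> Suc s" for j
      using that by (metis Suc_leI le_antisym)
    moreover have "n \<le> card B + Suc s" using B by simp
    ultimately have "x = y" using X_eqI[OF X] by blast
    then show "p = q" using xy by simp
  qed
  ultimately obtain g where g: "homeomorphism ?Q (?\<pi> ` ?Q) ?\<pi> g"
    using homeomorphism_compact by blast
  obtain x where x: "x \<in> X" "ties n x = B" using face_generic_point[OF B(2)] by blast
  have "s \<le> card (steps n x)" using card_ties_steps[of n x] x(2) B(1) by simp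
  then obtain \<eta> where \<eta>: "\<eta> > 0" "\<And>z. \<bar>z\<bar> < \<eta> \<Longrightarrow>
    \<exists>y\<in>X. ties n y = ties n x \<and> psum n y (Suc s) = psum n x (Suc s) + z"
    using no_local_extremum[OF x(1)] by blast
  define J where "J = ball (?\<pi> (?co x)) (\<eta> / real (Suc s))"
  have J: "J \<subseteq> ?\<pi> ` ?Q"
  proof
    fix t assume "t \<in> J"
    then have "\<bar>?\<pi> (?co x) - t\<bar> < \<eta> / real (Suc s)" by (simp add: J_def dist_real_def)
    then have "real (Suc s) * \<bar>?\<pi> (?co x) - t\<bar> < \<eta>" by (simp add: pos_less_divide_eq mult.commute)
    then have "\<bar>real (Suc s) * (?\<pi> (?co x) - t)\<bar> < \<eta>" by (simp add: abs_mult del: of_nat_Suc)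
    from \<eta>(2)[OF this] obtain y where y: "y \<in> X" "ties n y = ties n x"
      "psum n y (Suc s) = psum n x (Suc s) + real (Suc s) * (?\<pi> (?co x) - t)" by blast
    have "real (Suc s) * (?\<pi> (?co x) - ?\<pi> (?co y)) = real (Suc s) * (?\<pi> (?co x) - t)"
      using next_coeff_diff[OF ns, of x y] X_D(3)[OF x(1)] X_D(3)[OF y(1)] y(3) by simp
    then have "t = ?\<pi> (?co y)" by (simp del: of_nat_Suc)
    moreover have "y \<in> face B" using x y by (auto simp: face_def)
    ultimately show "t \<in> ?\<pi> ` ?Q" by blast
  qed
  define A where "A = {H \<in> root_poly n ` face B. Polynomial.coeff H \<in> g ` J}"
  have "g ` J \<subseteq> ?Q" using g J by (auto simp: homeomorphism_def)
  then have coA: "Polynomial.coeff ` A = g ` J"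
  proof (intro equalityI subsetI)
    fix q assume q: "q \<in> g ` J"
    then obtain z where "z \<in> face B" "q = ?co z" using \<open>g ` J \<subseteq> ?Q\<close> by blast
    then show "q \<in> Polynomial.coeff ` A" using q unfolding A_def by blast
  qed (auto simp: A_def)
  have top: "subtopology (powertop_real UNIV) S = top_of_set S" for S
    by (simp add: euclidean_product_topology)
  have "?\<pi> (g t) = t" if "t \<in> J" for t using g J that by (auto simp: homeomorphism_def)
  then have "?\<pi> ` (g ` J) = J" by (force simp: image_image)
  then have "homeomorphism (g ` J) J ?\<pi> g"
    by (rule homeomorphism_of_subsets[OF g \<open>g ` J \<subseteq> ?Q\<close> J])
  then have "J homeomorphic g ` J"
    by (metis homeomorphic_def homeomorphic_sym)
  moreover have "J homeomorphic (UNIV :: real set)"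
    unfolding J_def using \<eta>(1) by (intro homeomorphic_ball_UNIV) simp
  ultimately have "(UNIV :: real set) homeomorphic g ` J"
    using homeomorphic_sym homeomorphic_trans by blast
  then have "euclideanreal homeomorphic_space top_of_set (g ` J)"
    unfolding homeomorphic_def homeomorphic_space_def
    by (metis homeomorphic_maps_iff_homeomorphism subtopology_UNIV)
  then have "Euclidean_space 1 homeomorphic_space subtopology (powertop_real UNIV) (Polynomial.coeff ` A)"
    unfolding top coA using Euclidean_space_1 homeomorphic_space_trans by blast
  moreover have "A \<subseteq> root_poly n ` face B" by (auto simp: A_def)
  moreover have "e \<le> 1" if "A' \<subseteq> root_poly n ` face B"
    "Euclidean_space e homeomorphic_space subtopology (powertop_real UNIV) (Polynomial.coeff ` A')" for e A'
  proof (rule cell_dim_le_1[OF that(2)])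
    have sub: "Polynomial.coeff ` A' \<subseteq> ?Q" using that(1) by auto
    show "continuous_map (subtopology (powertop_real UNIV) (Polynomial.coeff ` A')) euclideanreal ?\<pi>"
      unfolding top using continuous_on_subset[OF co\<pi> sub] by simp
    show "inj_on ?\<pi> (topspace (subtopology (powertop_real UNIV) (Polynomial.coeff ` A')))"
      unfolding top using inj_on_subset[OF inj sub] by simp
  qed
  ultimately show ?thesis unfolding has_dimension_def Let_def by blast
qed

end

section \<open>Compositions and ties\<close>

text \<open>
  The proper nonzero partial sums. They determine a composition and turn the order of compositions
  into inclusion.
\<close>

definition cuts :: "nat list \<Rightarrow> nat set" where
  "cuts \<mu> = {sum_list (take k \<mu>) | k. 0 < k \<and> k < length \<mu>}"

lemma cuts_image: "cuts \<mu> = (\<lambda>k. sum_list (take k \<mu>)) ` {0<..<length \<mu>}"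
  by (auto simp: cuts_def)

lemma sum_list_take_less:
  assumes "\<forall>a\<in>set \<mu>. 0 < a" "j < k" "k \<le> length \<mu>"
  shows "sum_list (take j \<mu>) < sum_list (take k (\<mu> :: nat list))"
proof -
  have "take k \<mu> = take j \<mu> @ take (k - j) (drop j \<mu>)"
    using assms by (metis le_add_diff_inverse less_imp_le take_add)
  moreover
  let ?L = "take (k - j) (drop j \<mu>)"
  have "?L \<noteq> []" using assms by simp
  then have L: "hd ?L \<in> set ?L" by (rule hd_in_set)
  then have "hd ?L \<in> set \<mu>" by (meson in_set_dropD in_set_takeD)
  then have "0 < hd ?L" using assms(1) by blast
  moreover have "hd ?L \<le> sum_list ?L" by (rule member_le_sum_list[OF L]) simp
  ultimately show ?thesis by (metis add_strict_left_mono add.right_neutral order_less_le_trans sum_list_append)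
qed

lemma inj_on_partial_sums:
  assumes "\<forall>a\<in>set \<mu>. 0 < a"
  shows "inj_on (\<lambda>k. sum_list (take k \<mu>)) {..length (\<mu> :: nat list)}"
  using sum_list_take_less[OF assms] by (intro linorder_inj_onI) force+

lemma finite_cuts [simp]: "finite (cuts \<mu>)"
  by (simp add: cuts_image)

lemma cuts_subset: "composition n \<mu> \<Longrightarrow> cuts \<mu> \<subseteq> {0<..<n}"
  using sum_list_take_less[of \<mu> 0] sum_list_take_less[of \<mu> _ "length \<mu>"]
  by (fastforce simp: cuts_def composition_def)

lemma card_cuts: "composition n \<mu> \<Longrightarrow> card (cuts \<mu>) = length \<mu> - 1"
  using inj_on_subset[OF inj_on_partial_sums, of \<mu> "{0<..<length \<mu>}"]
  by (simp add: cuts_image card_image composition_def subset_iff)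

lemma cuts_Cons:
  assumes "\<mu> \<noteq> []"
  shows "cuts (a # \<mu>) = insert a ((+) a ` cuts \<mu>)"
proof -
  have "{0<..<length (a # \<mu>)} = Suc ` ({0} \<union> {0<..<length \<mu>})"
  proof (rule Set.set_eqI)
    fix k show "k \<in> {0<..<length (a # \<mu>)} \<longleftrightarrow> k \<in> Suc ` ({0} \<union> {0<..<length \<mu>})"
      using assms by (cases k) auto
  qed
  then show ?thesis unfolding cuts_image by (simp add: image_image image_Un)
qed

lemma cuts_append:
  assumes "\<mu> \<noteq> []" "\<nu> \<noteq> []"
  shows "cuts (\<mu> @ \<nu>) = cuts \<mu> \<union> insert (sum_list \<mu>) ((+) (sum_list \<mu>) ` cuts \<nu>)"
  using assms(1)
proof (induction \<mu>)
  case (Cons a \<mu>)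
  show ?case
  proof (cases "\<mu> = []")
    case True
    then show ?thesis using assms(2) by (simp add: cuts_Cons) (simp add: cuts_def)
  next
    case False
    then show ?thesis using Cons.IH assms(2)
      by (auto simp: cuts_Cons image_Un image_image add.assoc)
  qed
qed simp

lemma comp_le_iff_cuts:
  assumes "composition n \<mu>" "composition n \<nu>"
  shows "comp_le \<mu> \<nu> \<longleftrightarrow> cuts \<mu> \<subseteq> cuts \<nu>"
proof
  assume "comp_le \<mu> \<nu>"
  then obtain bs where bs: "[] \<notin> set bs" "concat bs = \<nu>" "map sum_list bs = \<mu>"
    by (auto simp: comp_le_def)
  show "cuts \<mu> \<subseteq> cuts \<nu>"
    using bs(1) unfolding bs(2)[symmetric] bs(3)[symmetric]
  proof (induction bs)
    case (Cons b bs)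
    show ?case
    proof (cases "bs = []")
      case True
      then show ?thesis by (simp add: cuts_def)
    next
      case False
      then have "concat bs \<noteq> []" using Cons.prems by (cases bs) auto
      moreover have "b \<noteq> []" using Cons.prems by auto
      moreover have "cuts (map sum_list bs) \<subseteq> cuts (concat bs)" using Cons by simp
      ultimately show ?thesis using False cuts_append[of b "concat bs"] by (auto simp: cuts_Cons)
    qed
  qed simp
next
  assume "cuts \<mu> \<subseteq> cuts \<nu>"
  then show "comp_le \<mu> \<nu>" using assms
  proof (induction \<mu> arbitrary: \<nu> n)
    case Nil
    then have "\<nu> = []" by (cases \<nu>) (auto simp: composition_def)
    then show ?case by (auto simp: comp_le_def intro: exI[of _ "[]"])
  next
    case (Cons a \<mu>)
    show ?case
    proof (cases "\<mu> = []")
      case True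
      have "\<nu> \<noteq> []" "sum_list \<nu> = a" using Cons.prems True by (auto simp: composition_def)
      then show ?thesis using True by (auto simp: comp_le_def intro!: exI[of _ "[\<nu>]"])
    next
      case False
      then have "a \<in> cuts \<nu>" using Cons.prems(1) by (simp add: cuts_Cons)
      then obtain k where k: "0 < k" "k < length \<nu>" "sum_list (take k \<nu>) = a"
        by (auto simp: cuts_def)
      let ?b = "take k \<nu>" and ?\<nu> = "drop k \<nu>"
      have ne: "?b \<noteq> []" "?\<nu> \<noteq> []" using k by auto
      have \<nu>: "\<nu> = ?b @ ?\<nu>" by simp
      have sum: "sum_list \<nu> = a + sum_list ?\<nu>" using k(3) by (metis \<nu> sum_list_append)
      have c\<mu>: "composition (n - a) \<mu>" using Cons.prems(2) by (auto simp: composition_def)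
      have c\<nu>: "composition (n - a) ?\<nu>" 
        using Cons.prems(3) sum by (auto simp: composition_def dest: in_set_dropD)
      have cut\<nu>: "cuts \<nu> = cuts ?b \<union> insert a ((+) a ` cuts ?\<nu>)"
        using cuts_append[OF ne] k(3) by simp
      have cb: "composition a ?b" using Cons.prems(3) k(3) by (auto simp: composition_def dest: in_set_takeD)
      have "cuts \<mu> \<subseteq> cuts ?\<nu>"
      proof
        fix x assume x: "x \<in> cuts \<mu>"
        then have "a + x \<in> cuts \<nu>" using Cons.prems(1) False by (auto simp: cuts_Cons)
        moreover have "0 < x" using cuts_subset[OF c\<mu>] x by auto
        ultimately show "x \<in> cuts ?\<nu>" using cuts_subset[OF cb] cut\<nu> by auto
      qed
      then obtain bs where "[] \<notin> set bs" "concat bs = ?\<nu>" "map sum_list bs = \<mu>"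
        using Cons.IH[OF _ c\<mu> c\<nu>] by (auto simp: comp_le_def)
      then show ?thesis unfolding comp_le_def
        using ne k(3) by (intro exI[of _ "?b # bs"]) auto
    qed
  qed
qed

text \<open>
  The multiplicities of the first \<open>k\<close> distinct roots add up to the number of indices whose entry is at
  most the \<open>k\<close>-th root, that is, to the position of the \<open>k\<close>-th step.
\<close>

lemma root_composition_root_poly:
  assumes x: "mono_on {..<n} x"
  shows "composition n (root_composition (root_poly n x))"
    and "cuts (root_composition (root_poly n x)) = Suc ` steps n x"
proof -
  let ?H = "root_poly n x"
  define zs where "zs = sorted_list_of_set (x ` {..<n})"
  have zs: "set zs = x ` {..<n}" "sorted zs" "distinct zs" by (auto simp: zs_def)
  have "{t. poly ?H t = 0} = x ` {..<n}" by (auto simp: poly_root_poly)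
  then have rc: "root_composition ?H = map (\<lambda>a. card {i. i < n \<and> x i = a}) zs"
    by (simp add: root_composition_def zs_def order_root_poly)
  have part: "sum_list (map (\<lambda>a. card {i. i < n \<and> x i = a}) ys) = card {i. i < n \<and> x i \<in> set ys}"
    if "distinct ys" for ys
    using that
  proof (induction ys)
    case (Cons a ys)
    have "{i. i < n \<and> x i \<in> set (a # ys)} = {i. i < n \<and> x i = a} \<union> {i. i < n \<and> x i \<in> set ys}"
      by auto
    moreover have "card ({i. i < n \<and> x i = a} \<union> {i. i < n \<and> x i \<in> set ys}) =
      card {i. i < n \<and> x i = a} + card {i. i < n \<and> x i \<in> set ys}"
      using Cons.prems by (intro card_Un_disjoint) auto
    ultimately show ?case using Cons by simp
  qed simp
  have "{i. i < n \<and> x i \<in> set zs} = {..<n}" using zs by auto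
  then have sum: "sum_list (root_composition ?H) = n" using part[OF zs(3)] by (simp add: rc)
  have "0 < card {i. i < n \<and> x i = a}" if "a \<in> set zs" for a
    using that zs(1) by (auto simp: card_gt_0_iff)
  then show "composition n (root_composition ?H)" using sum by (auto simp: composition_def rc)
  have initial: "{i. i < n \<and> x i \<in> set (take k zs)} = {..<m}"
    if k: "0 < k" "k \<le> length zs" and m: "m = Suc (Max {i. i < n \<and> x i = zs ! (k - 1)})" for k m
  proof -
    let ?S = "{i. i < n \<and> x i = zs ! (k - 1)}"
    have "zs ! (k - 1) \<in> x ` {..<n}" using k zs(1) by (metis Suc_diff_1 Suc_le_eq nth_mem)
    then have "?S \<noteq> {}" by auto
    then have mx: "Max ?S \<in> ?S" by (intro Max_in) auto
    have "x i \<in> set (take k zs) \<longleftrightarrow> i < m" if i: "i < n" for i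
    proof
      assume "x i \<in> set (take k zs)"
      then obtain j where j: "j < k" "j < length zs" "x i = zs ! j" by (auto simp: in_set_conv_nth)
      then have le: "x i \<le> zs ! (k - 1)" using zs(2) k by (simp add: sorted_nth_mono)
      show "i < m"
      proof (rule ccontr)
        assume "\<not> i < m"
        then have "Max ?S < i" using m by simp
        then have "x (Max ?S) \<le> x i" using mx i by (intro mono_onD[OF x]) auto
        then have "i \<in> ?S" using mx le i by auto
        then show False using \<open>Max ?S < i\<close> by (metis (no_types, lifting) Max_ge finite_subset finite_lessThan linorder_not_le mem_Collect_eq lessThan_iff subsetI)
      qed
    next
      assume "i < m"
      then have "x i \<le> x (Max ?S)" using mx i m by (intro mono_onD[OF x]) auto
      then have le: "x i \<le> zs ! (k - 1)" using mx by simp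
      obtain j where j: "j < length zs" "zs ! j = x i"
        using zs(1) i by (metis imageI in_set_conv_nth lessThan_iff)
      have "j < k"
      proof (rule ccontr)
        assume "\<not> j < k"
        then have "zs ! (k - 1) < zs ! j"
          using zs(2,3) j k by (metis One_nat_def Suc_pred le_less_linear less_le_trans lessI
              linorder_neqE_nat nth_eq_iff_index_eq order_le_less order_less_le sorted_iff_nth_mono)
        then show False using le j by simp
      qed
      then show "x i \<in> set (take k zs)" using j by (auto simp: in_set_conv_nth intro!: exI[of _ j])
    qed
    moreover have "m \<le> n" using mx m by auto
    ultimately show ?thesis by auto
  qed
  have partial: "sum_list (take k (root_composition ?H)) = Suc (Max {i. i < n \<and> x i = zs ! (k - 1)})"
    if k: "0 < k" "k \<le> length zs" for k
  proof -
    have "sum_list (take k (root_composition ?H)) = card {i. i < n \<and> x i \<in> set (take k zs)}"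
      unfolding rc take_map by (rule part) (use zs in simp)
    then show ?thesis using initial[OF k refl] by simp
  qed
  show "cuts (root_composition ?H) = Suc ` steps n x"
  proof (intro equalityI subsetI)
    fix m assume "m \<in> cuts (root_composition ?H)"
    then obtain k where k: "0 < k" "k < length zs" "m = sum_list (take k (root_composition ?H))"
      by (auto simp: cuts_def rc)
    let ?S = "{i. i < n \<and> x i = zs ! (k - 1)}"
    have m: "m = Suc (Max ?S)" using partial k by simp
    have "zs ! (k - 1) \<in> x ` {..<n}" using k zs(1) by (metis Suc_diff_1 Suc_lessD nth_mem)
    then have "?S \<noteq> {}" by auto
    then have mx: "Max ?S \<in> ?S" by (intro Max_in) auto
    have "m < n"
    proof -
      have "m \<in> {0<..<n}"
        using \<open>composition n (root_composition ?H)\<close> cuts_subset \<open>m \<in> cuts _\<close> by blast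
      then show ?thesis by simp
    qed
    moreover have "x (Max ?S) \<noteq> x m"
    proof
      assume "x (Max ?S) = x m"
      then have "m \<in> ?S" using mx \<open>m < n\<close> by auto
      then have "m \<le> Max ?S" by (intro Max_ge) auto
      then show False using m by simp
    qed
    ultimately show "m \<in> Suc ` steps n x" using m by (auto simp: steps_def)
  next
    fix m assume "m \<in> Suc ` steps n x"
    then obtain i where i: "m = Suc i" "Suc i < n" "x i \<noteq> x (Suc i)" by (auto simp: steps_def)
    have lt: "x i < x (Suc i)" using x i by (auto simp: mono_on_def order_less_le)
    obtain j where j: "j < length zs" "zs ! j = x i"
      using zs(1) i by (metis Suc_lessD imageI in_set_conv_nth lessThan_iff)
    obtain j' where j': "j' < length zs" "zs ! j' = x (Suc i)"
      using zs(1) i by (metis imageI in_set_conv_nth lessThan_iff)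
    have "j < j'" using lt j j' zs(2) by (metis leD leI sorted_iff_nth_mono)
    then have k: "0 < Suc j" "Suc j < length zs" using j' by auto
    have "Max {k. k < n \<and> x k = zs ! j} = i"
    proof (rule Max_eqI)
      fix k assume "k \<in> {k. k < n \<and> x k = zs ! j}"
      then have "k < n" "x k = x i" using j by auto
      show "k \<le> i"
      proof (rule ccontr)
        assume "\<not> k \<le> i"
        then have "x (Suc i) \<le> x k" using x \<open>k < n\<close> by (auto simp: mono_on_def)
        then show False using lt \<open>x k = x i\<close> by simp
      qed
    qed (use i j in auto)
    then have "sum_list (take (Suc j) (root_composition ?H)) = m" using partial[of "Suc j"] k i by simp
    then show "m \<in> cuts (root_composition ?H)" unfolding cuts_def using k rc by auto
  qed
qed

definition comp_ties :: "nat \<Rightarrow> nat list \<Rightarrow> nat set" where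
  "comp_ties n \<mu> = {i. Suc i < n \<and> Suc i \<notin> cuts \<mu>}"

lemma comp_le_iff_ties:
  assumes "mono_on {..<n} x" "composition n \<mu>"
  shows "comp_le (root_composition (root_poly n x)) \<mu> \<longleftrightarrow> comp_ties n \<mu> \<subseteq> ties n x"
  using comp_le_iff_cuts[OF root_composition_root_poly(1)[OF assms(1)] assms(2)]
    root_composition_root_poly(2)[OF assms(1)]
  by (auto simp: comp_ties_def ties_def steps_def)

lemma card_comp_ties:
  assumes "composition n \<mu>"
  shows "card (comp_ties n \<mu>) = n - length \<mu>"
proof -
  have c: "cuts \<mu> \<subseteq> {0<..<n}" by (rule cuts_subset[OF assms])
  have "Suc ` comp_ties n \<mu> = {0<..<n} - cuts \<mu>"
    by (auto simp: comp_ties_def image_iff gr0_conv_Suc)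
  then have "card (comp_ties n \<mu>) = card ({0<..<n} - cuts \<mu>)"
    by (metis card_image inj_Suc)
  also have "\<dots> = card {0<..<n} - card (cuts \<mu>)" using c by (intro card_Diff_subset) auto
  also have "\<dots> = n - length \<mu>"
    using assms by (cases "\<mu> = []") (auto simp: card_cuts[OF assms] composition_def)
  finally show ?thesis .
qed

text \<open>
  A composition with prescribed cuts is obtained as the root composition of a vector with prescribed
  steps.
\<close>

lemma ex_composition_ties:
  assumes "A \<subseteq> {..<n - 1}"
  obtains \<mu> where "composition n \<mu>" "comp_ties n \<mu> = A"
proof -
  let ?x = "\<lambda>i. real (card (({..<n - 1} - A) \<inter> {..<i}))"
  have "?x i \<le> ?x j" if "i \<le> j" for i j using that by (auto intro!: card_mono)
  then have x: "mono_on {..<n} ?x" by (auto simp: mono_on_def)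
  have "?x (Suc i) = (if i < n - 1 \<and> i \<notin> A then ?x i + 1 else ?x i)" for i
    by (auto simp: lessThan_Suc Int_insert_right)
  then have "steps n ?x = {..<n - 1} - A" by (auto simp: steps_def)
  then have "comp_ties n (root_composition (root_poly n ?x)) = A"
    using assms root_composition_root_poly(2)[OF x] by (auto simp: comp_ties_def image_iff)
  then show thesis using root_composition_root_poly(1)[OF x] that by blast
qed

lemma comp_ties_subset: "comp_ties n \<mu> \<subseteq> {..<n - 1}"
  by (auto simp: comp_ties_def)

section \<open>Shellings and linear orders\<close>

text \<open>
  The usual reformulation: the intersection of a facet with the earlier ones is pure of codimension
  one when the intersection with any earlier facet lies in a ridge shared with some earlier facet.
\<close>

lemma shellingI:
  assumes K: "simplicial_complex K" and card: "\<And>A. A \<in> facets K \<Longrightarrow> card A = d"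
    and xs: "distinct \<Phi>s" "set \<Phi>s = facets K"
    and step: "\<And>i j. i < length \<Phi>s \<Longrightarrow> j < i \<Longrightarrow>
      \<exists>k<i. \<Phi>s ! j \<inter> \<Phi>s ! i \<subseteq> \<Phi>s ! k \<and> Suc (card (\<Phi>s ! k \<inter> \<Phi>s ! i)) = d"
  shows "shelling K \<Phi>s"
proof -
  have fin: "finite K" "K \<noteq> {}" "\<And>A. A \<in> K \<Longrightarrow> finite A" "\<And>A B. A \<in> K \<Longrightarrow> B \<subseteq> A \<Longrightarrow> B \<in> K"
    using K by (auto simp: simplicial_complex_def)
  have ex_facet: "\<exists>B\<in>facets K. A \<subseteq> B" if "A \<in> K" for A
    using finite_has_maximal2[OF fin(1) that] by (auto simp: facets_def)
  have le: "card A \<le> d" if A: "A \<in> K" for A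
  proof -
    obtain B where "B \<in> facets K" "A \<subseteq> B" using ex_facet[OF A] by blast
    then show ?thesis using card[of B] card_mono[of B A] fin(3)[of B] by (auto simp: facets_def)
  qed
  obtain A0 where A0: "A0 \<in> facets K" using ex_facet fin(2) by blast
  have dim: "complex_dim K = int d - 1"
    unfolding complex_dim_def
  proof (rule Max_eqI)
    show "finite (face_dim ` K)" using fin(1) by simp
    fix k assume "k \<in> face_dim ` K"
    then obtain A where "A \<in> K" "k = face_dim A" by blast
    then show "k \<le> int d - 1" using le[of A] by (simp add: face_dim_def)
  next
    show "int d - 1 \<in> face_dim ` K"
      using A0 card[OF A0] by (auto simp: face_dim_def facets_def intro!: image_eqI[of _ _ A0])
  qed
  have pure: "pure_of_dim ((\<Union>j<i. Pow (\<Phi>s ! j)) \<inter> Pow (\<Phi>s ! i)) (complex_dim K - 1)"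
    if i: "1 \<le> i" "i < length \<Phi>s" for i
    unfolding pure_of_dim_def
  proof (intro conjI ballI)
    let ?L = "(\<Union>j<i. Pow (\<Phi>s ! j)) \<inter> Pow (\<Phi>s ! i)"
    have "0 < i" using i by simp
    then have "{} \<in> ?L" by auto
    then show "?L \<noteq> {}" by blast
    fix A assume A: "A \<in> facets ?L"
    then obtain j where j: "j < i" "A \<subseteq> \<Phi>s ! j \<inter> \<Phi>s ! i" by (auto simp: facets_def)
    then obtain k where k: "k < i" "\<Phi>s ! j \<inter> \<Phi>s ! i \<subseteq> \<Phi>s ! k" "Suc (card (\<Phi>s ! k \<inter> \<Phi>s ! i)) = d"
      using step[OF i(2)] by blast
    have "\<Phi>s ! k \<inter> \<Phi>s ! i \<in> ?L" "A \<subseteq> \<Phi>s ! k \<inter> \<Phi>s ! i" using j k by auto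
    then have "A = \<Phi>s ! k \<inter> \<Phi>s ! i" using A by (auto simp: facets_def)
    then show "face_dim A = complex_dim K - 1" using k(3) dim by (simp add: face_dim_def)
  qed
  show ?thesis
    unfolding shelling_def using K xs pure fin(2) card dim
    by (auto simp: pure_of_dim_def face_dim_def)
qed

text \<open>
  Sorting by the number of predecessors turns the linear order into a sort by a natural number key.
\<close>

lemma linear_order_sorted_list:
  assumes A: "finite A" and r: "linear_order_on A r"
  obtains xs where "set xs = A" "distinct xs" "sorted_wrt (\<lambda>a b. (a, b) \<in> r) xs"
proof -
  have r': "refl_on A r" "trans r" "antisym r" "total_on A r"
    using r by (auto simp: order_on_defs)
  define f where "f a = card {b \<in> A. (b, a) \<in> r}" for a
  obtain l where l: "set l = A" "distinct l" using finite_distinct_list[OF A] by blast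
  have "(a, b) \<in> r" if ab: "a \<in> A" "b \<in> A" "f a \<le> f b" for a b
  proof (rule ccontr)
    assume n: "(a, b) \<notin> r"
    then have ne: "a \<noteq> b" using r'(1) ab by (auto simp: refl_on_def)
    then have "(b, a) \<in> r" using r'(4) ab n by (auto simp: total_on_def)
    then have "{c \<in> A. (c, b) \<in> r} \<subset> {c \<in> A. (c, a) \<in> r}"
      using r'(1,2) n ab by (auto simp: refl_on_def dest: transD)
    then have "f b < f a" unfolding f_def using A by (intro psubset_card_mono) auto
    then show False using ab by simp
  qed
  moreover have "sorted_wrt (\<lambda>a b. f a \<le> f b) (sort_key f l)"
    using sorted_sort_key[of f l] by (simp add: sorted_map)
  ultimately have "sorted_wrt (\<lambda>a b. (a, b) \<in> r) (sort_key f l)"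
    using l by (auto intro: sorted_wrt_mono_rel[rotated])
  then show thesis using l by (intro that[of "sort_key f l"]) auto
qed

section \<open>Strata as faces of a shellable complex\<close>

lemma card_values:
  assumes "mono_on {..<n} x" "0 < n"
  shows "card {t. poly (root_poly n x) t = 0} = Suc (card (steps n x))"
proof -
  let ?c = "root_composition (root_poly n x)"
  have c: "composition n ?c" "cuts ?c = Suc ` steps n x"
    using root_composition_root_poly[OF assms(1)] by auto
  have "length ?c = card {t. poly (root_poly n x) t = 0}"
    by (simp add: root_composition_def)
  moreover have "?c \<noteq> []" using c(1) assms(2) by (auto simp: composition_def)
  moreover have "card (steps n x) = length ?c - 1"
    using card_cuts[OF c(1)] c(2) by (simp add: card_image)
  ultimately show ?thesis by (cases ?c) auto
qed

context generic_moment_slice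
begin

definition face_complex :: "nat set set" where
  "face_complex = {A. face A \<noteq> {}}"

definition stratum :: "nat set \<Rightarrow> real poly set" where
  "stratum A = root_poly n ` face A"

lemma face_complex_subset: "A \<in> face_complex \<Longrightarrow> A \<subseteq> {..<n - 1}"
  by (auto simp: face_complex_def face_def ties_def)

lemma simplicial_complex_face_complex:
  assumes "X \<noteq> {}"
  shows "simplicial_complex face_complex"
proof -
  have sub: "face_complex \<subseteq> Pow {..<n - 1}" using face_complex_subset by auto
  show ?thesis
    unfolding simplicial_complex_def
  proof (intro conjI ballI allI impI)
    show "finite face_complex" using sub by (rule finite_subset) simp
    show "face_complex \<noteq> {}" using assms by (auto simp: face_complex_def face_def)
    show "finite A" if "A \<in> face_complex" for A
      using face_complex_subset[OF that] finite_subset by blast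
    show "B \<in> face_complex" if "A \<in> face_complex" "B \<subseteq> A" for A B
      using that unfolding face_complex_def face_def by blast
  qed
qed

text \<open>
  Every nonempty face contains a vertex, where the height is maximal; a vertex has the maximal number
  of ties.
\<close>

lemma facets_face_complex: "facets face_complex = ties n ` vertices"
proof (intro equalityI subsetI)
  fix A assume A: "A \<in> facets face_complex"
  then have "face A \<noteq> {}" by (auto simp: facets_def face_complex_def)
  then obtain w where w: "w \<in> face A" "w \<in> vertices" using height_attains_max by metis
  then have "A \<subseteq> ties n w" "ties n w \<in> face_complex" by (auto simp: face_def face_complex_def)
  then have "A = ties n w" using A by (auto simp: facets_def)
  then show "A \<in> ties n ` vertices" using w by blast
next
  fix A assume "A \<in> ties n ` vertices"
  then obtain x where x: "x \<in> vertices" "A = ties n x" by blast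
  have "A = B" if B: "B \<in> face_complex" "A \<subseteq> B" for B
  proof -
    obtain y where y: "y \<in> X" "B \<subseteq> ties n y" using B by (auto simp: face_complex_def face_def)
    then have "y = x" using vertex_eqI[OF x(1) y(1)] x(2) B(2) by blast
    then show ?thesis using y x B by blast
  qed
  moreover have "A \<in> face_complex" using x by (auto simp: face_complex_def face_def vertices_def)
  ultimately show "A \<in> facets face_complex" by (auto simp: facets_def)
qed

lemma stratum_mono_iff:
  assumes "A \<in> face_complex" "B \<in> face_complex"
  shows "stratum A \<supseteq> stratum B \<longleftrightarrow> A \<subseteq> B"
proof
  assume *: "stratum A \<supseteq> stratum B"
  obtain x where x: "x \<in> X" "ties n x = B"
    using face_generic_point assms(2) by (auto simp: face_complex_def)
  then have "root_poly n x \<in> stratum A" using * by (auto simp: stratum_def face_def)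
  then obtain y where y: "y \<in> face A" "root_poly n x = root_poly n y" by (auto simp: stratum_def)
  then have "x = y"
    using x inj_onD[OF inj_on_root_poly, of n x y] by (auto simp: face_def moment_slice_def)
  then show "A \<subseteq> B" using x y by (auto simp: face_def)
qed (auto simp: stratum_def face_def)

lemma inj_on_stratum: "inj_on stratum face_complex"
  using stratum_mono_iff by (intro inj_onI) (metis subset_antisym subset_refl)

lemma face_vertex:
  assumes "x \<in> vertices"
  shows "face (ties n x) = {x}"
  using assms vertex_eqI[OF assms] by (auto simp: face_def vertices_def)

text \<open>
  Let \<open>w\<close> precede \<open>x\<close>. Then \<open>x\<close> cannot lie above \<open>w\<close> in the edge order, which leaves the other case
  of the shelling step: a vertex \<open>v\<close> adjacent to \<open>x\<close> and above it, hence listed earlier.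
\<close>

lemma induces_shelling_linear_order:
  assumes ne: "X \<noteq> {}"
    and r: "linear_order_on {{root_poly n x} | x. x \<in> vertices} r"
    and fine: "\<And>u v. u \<in> vertices \<Longrightarrow> v \<in> vertices \<Longrightarrow> (u, v) \<in> (edge e)\<^sup>* \<Longrightarrow>
      ({root_poly n u}, {root_poly n v}) \<in> r"
  shows "induces_shelling (stratum ` face_complex) (\<supseteq>) {{root_poly n x} | x. x \<in> vertices} r"
proof -
  let ?V = "{{root_poly n x} | x. x \<in> vertices}"
  have V: "?V = (\<lambda>x. {root_poly n x}) ` vertices" by auto
  then have "finite ?V" using finite_vertices by simp
  from linear_order_sorted_list[OF this r] obtain xs where xs: "set xs = ?V" "distinct xs" "sorted_wrt (\<lambda>a b. (a, b) \<in> r) xs" .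
  have anti: "a = b" if "(a, b) \<in> r" "(b, a) \<in> r" for a b
    using r that by (auto simp: order_on_defs antisym_def)
  have sv: "stratum (ties n x) = {root_poly n x}" "ties n x \<in> face_complex" if "x \<in> vertices" for x
    using face_vertex[OF that] by (auto simp: stratum_def face_complex_def)
  define \<phi> where "\<phi> = the_inv_into face_complex stratum"
  have \<phi>: "\<phi> (stratum A) = A" if "A \<in> face_complex" for A
    unfolding \<phi>_def by (rule the_inv_into_f_f[OF inj_on_stratum that])
  have \<phi>v: "\<phi> {root_poly n x} = ties n x" if "x \<in> vertices" for x
    using \<phi>[OF sv(2)[OF that]] sv(1)[OF that] by simp
  have bij: "bij_betw \<phi> (stratum ` face_complex) face_complex"
    unfolding \<phi>_def by (rule bij_betw_the_inv_into) (simp add: inj_on_stratum bij_betw_def)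
  have sub: "set xs \<subseteq> stratum ` face_complex" unfolding xs(1) using sv by blast
  have "shelling face_complex (map \<phi> xs)"
  proof (rule shellingI[where d = "n - s"])
    show "simplicial_complex face_complex" by (rule simplicial_complex_face_complex[OF ne])
    show "card A = n - s" if "A \<in> facets face_complex" for A
      using that by (auto simp: facets_face_complex vertices_def)
    show "distinct (map \<phi> xs)"
      using xs(2) inj_on_subset[OF bij_betw_imp_inj_on[OF bij] sub] by (simp add: distinct_map)
    have "\<phi> ` ?V = ties n ` vertices" unfolding V image_image using \<phi>v by (rule image_cong[OF refl])
    then show "set (map \<phi> xs) = facets face_complex" using xs(1) by (simp add: facets_face_complex)
  next
    fix i j assume "i < length (map \<phi> xs)" and ji: "j < i"
    then have i: "i < length xs" "j < length xs" by auto
    obtain x where x: "x \<in> vertices" "xs ! i = {root_poly n x}"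
      using nth_mem[OF i(1)] xs(1) by auto
    obtain w where w: "w \<in> vertices" "xs ! j = {root_poly n w}"
      using nth_mem[OF i(2)] xs(1) by auto
    have "(xs ! j, xs ! i) \<in> r" using sorted_wrt_nth_less[OF xs(3) ji i(1)] .
    moreover have "xs ! j \<noteq> xs ! i" using xs(2) i ji by (simp add: nth_eq_iff_index_eq)
    ultimately have "(xs ! i, xs ! j) \<notin> r" using anti by blast
    then have "(x, w) \<notin> (edge e)\<^sup>*" using fine x w by auto
    then obtain v where v: "(v, x) \<in> edge e" "ties n x \<inter> ties n w \<subseteq> ties n v"
      "v \<noteq> x" "Suc (card (ties n x \<inter> ties n v)) = n - s"
      using shelling_step[OF x(1) w(1)] by blast
    have vV: "v \<in> vertices" using v(1) by (auto simp: edge_def)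
    then have "{root_poly n v} \<in> set xs" using xs(1) by blast
    then obtain k where k: "k < length xs" "xs ! k = {root_poly n v}" by (auto simp: in_set_conv_nth)
    have vx: "(xs ! k, xs ! i) \<in> r" using fine[OF vV x(1)] v(1) x k by auto
    have "root_poly n v \<noteq> root_poly n x"
      using inj_onD[OF inj_on_root_poly, of n v x] v(3) vV x(1)
      by (auto simp: vertices_def moment_slice_def)
    then have "xs ! k \<noteq> xs ! i" using k x by simp
    have "k < i"
    proof (rule ccontr)
      assume "\<not> k < i"
      then have "i < k" using \<open>xs ! k \<noteq> xs ! i\<close> by (metis linorder_neqE_nat)
      then have "(xs ! i, xs ! k) \<in> r" using sorted_wrt_nth_less[OF xs(3)] k(1) by blast
      then show False using vx anti \<open>xs ! k \<noteq> xs ! i\<close> by blast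
    qed
    then show "\<exists>k<i. map \<phi> xs ! j \<inter> map \<phi> xs ! i \<subseteq> map \<phi> xs ! k \<and>
        Suc (card (map \<phi> xs ! k \<inter> map \<phi> xs ! i)) = n - s"
      using v(2,4) i k x w vV \<phi>v by (intro exI[of _ k]) (auto simp: Int_commute)
  qed
  moreover have "\<forall>a\<in>stratum ` face_complex. \<forall>b\<in>stratum ` face_complex. (a \<supseteq> b) \<longleftrightarrow> \<phi> a \<subseteq> \<phi> b"
    using stratum_mono_iff \<phi> by auto
  ultimately have "poset_shelling (stratum ` face_complex) (\<supseteq>) xs"
    unfolding poset_shelling_def using sub bij by blast
  then show ?thesis unfolding induces_shelling_def using xs by blast
qed

end

lemma hyp_slice_root_poly:
  assumes "s \<le> n" "F = root_poly n x0"
  shows "hyp_slice n s F = root_poly n ` moment_slice n s (psum n x0)"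
  unfolding hyp_slice_def moment_slice_def monic_hyperbolic_eq assms(2)
  using coeffs_eq_iff_psums_eq[OF assms(1), of _ x0] by auto

lemma generic_moment_slice_root_poly:
  assumes "2 \<le> s" "s \<le> n" "generic_slice n s F" "F = root_poly n x0"
  shows "generic_moment_slice n s (psum n x0)"
proof
  fix x assume x: "x \<in> moment_slice n s (psum n x0)"
  then have "root_poly n x \<in> hyp_slice n s F" using hyp_slice_root_poly[OF assms(2,4)] by blast
  then have "s - 1 < card {t. poly (root_poly n x) t = 0}"
    using assms(3) by (auto simp: generic_slice_def)
  also have "\<dots> = Suc (card (steps n x))"
    using x assms by (intro card_values) (auto simp: moment_slice_def root_vectors_def)
  finally show "s \<le> Suc (card (steps n x))" by simp
qed (use assms in auto)

context
  fixes n s :: nat and F :: "real poly" and x0 :: "nat \<Rightarrow> real"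
  assumes s2: "2 \<le> s" and sn: "s \<le> n" and gen: "generic_slice n s F"
    and F: "F = root_poly n x0"
begin

interpretation generic_moment_slice n s "psum n x0"
  by (rule generic_moment_slice_root_poly[OF s2 sn gen F])

lemma hyp_stratum_eq:
  assumes "composition n \<mu>"
  shows "hyp_stratum n s F \<mu> = stratum (comp_ties n \<mu>)"
  unfolding hyp_stratum_def hyp_slice_root_poly[OF sn F] stratum_def face_def
  using comp_le_iff_ties[OF X_D(1) assms] by auto

lemma strata_eq: "strata n s F = {stratum A | A. A \<subseteq> {..<n - 1}}"
proof (intro equalityI subsetI)
  fix S assume "S \<in> strata n s F"
  then obtain \<mu> where "composition n \<mu>" "S = hyp_stratum n s F \<mu>" by (auto simp: strata_def)
  then show "S \<in> {stratum A | A. A \<subseteq> {..<n - 1}}"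
    using hyp_stratum_eq[of \<mu>] comp_ties_subset[of n \<mu>] by blast
next
  fix S assume "S \<in> {stratum A | A. A \<subseteq> {..<n - 1}}"
  then obtain A where A: "S = stratum A" "A \<subseteq> {..<n - 1}" by blast
  then obtain \<mu> where "composition n \<mu>" "comp_ties n \<mu> = A" using ex_composition_ties by blast
  then show "S \<in> strata n s F" using A hyp_stratum_eq by (auto simp: strata_def)
qed

lemma boundary_complex_eq: "boundary_complex n s F = stratum ` face_complex"
proof -
  have "stratum A = {} \<longleftrightarrow> A \<notin> face_complex" for A by (auto simp: stratum_def face_complex_def)
  then show ?thesis
    unfolding boundary_complex_def strata_eq using face_complex_subset by auto
qed

lemma slice_facets_eq: "slice_facets n s F = {{root_poly n x} | x. x \<in> vertices}"
proof (intro equalityI subsetI)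
  fix S assume "S \<in> slice_facets n s F"
  then obtain \<gamma> x where g: "S = hyp_stratum n s F \<gamma>" "composition n \<gamma>" "length \<gamma> = s"
      "x \<in> X" "root_composition (root_poly n x) = \<gamma>"
    using hyp_slice_root_poly[OF sn F] by (auto simp: slice_facets_def occurs_def)
  have ties: "comp_ties n \<gamma> = ties n x"
    using root_composition_root_poly(2)[OF X_D(1)[OF g(4)]] g(5)
    by (auto simp: comp_ties_def ties_def steps_def)
  then have "x \<in> vertices" using card_comp_ties[OF g(2)] g by (simp add: vertices_def)
  moreover have "S = {root_poly n x}"
    using face_vertex[OF \<open>x \<in> vertices\<close>] hyp_stratum_eq[OF g(2)] g(1) ties by (simp add: stratum_def)
  ultimately show "S \<in> {{root_poly n x} | x. x \<in> vertices}" by blast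
next
  fix S assume "S \<in> {{root_poly n x} | x. x \<in> vertices}"
  then obtain x where x: "x \<in> vertices" "S = {root_poly n x}" by blast
  let ?\<gamma> = "root_composition (root_poly n x)"
  have xX: "x \<in> X" using x by (simp add: vertices_def)
  have g: "composition n ?\<gamma>" "cuts ?\<gamma> = Suc ` steps n x"
    using root_composition_root_poly[OF X_D(1)[OF xX]] by auto
  have ties: "comp_ties n ?\<gamma> = ties n x"
    using g(2) by (auto simp: comp_ties_def ties_def steps_def)
  have "length ?\<gamma> = card {t. poly (root_poly n x) t = 0}" by (simp add: root_composition_def)
  also have "\<dots> = s"
    using card_values[OF X_D(1)[OF xX]] vertices_card_steps[OF x(1)] s2 sn by simp
  finally have "length ?\<gamma> = s" .
  moreover have "occurs n s F ?\<gamma>"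
    using xX hyp_slice_root_poly[OF sn F] by (auto simp: occurs_def)
  moreover have "S = hyp_stratum n s F ?\<gamma>"
    using face_vertex[OF x(1)] hyp_stratum_eq[OF g(1)] x(2) ties by (simp add: stratum_def)
  ultimately show "S \<in> slice_facets n s F" using g(1) by (auto simp: slice_facets_def)
qed

lemma edge_in_order_p_gen:
  assumes "(u, v) \<in> edge True"
  shows "({root_poly n u}, {root_poly n v}) \<in> order_p_gen n s F"
proof -
  obtain B where uv: "u \<in> vertices" "v \<in> vertices" and B: "Suc (card B) = n - s"
     "u \<in> face B" "v \<in> face B"
     "\<And>y. y \<in> face B \<Longrightarrow> height True v \<le> height True y \<and> height True y \<le> height True u"
    using assms by (auto simp: edge_def)
  have ns: "s < n" using B by simp
  have "B \<subseteq> {..<n - 1}" using B(2) by (auto simp: face_def ties_def)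
  then have "stratum B \<in> strata n s F" unfolding strata_eq by blast
  moreover have "has_dimension (stratum B) 1"
    unfolding stratum_def using B by (intro edge_has_dimension_1) auto
  moreover have compare: "Polynomial.coeff (root_poly n x) (n - s - 1) \<le> Polynomial.coeff (root_poly n y) (n - s - 1)"
    if xy: "x \<in> face B" "y \<in> face B" "height True y \<le> height True x" for x y
  proof -
    have X: "x \<in> X" "y \<in> X" using xy by (auto simp: face_def)
    have "real (Suc s) * (Polynomial.coeff (root_poly n x) (n - Suc s) -
       Polynomial.coeff (root_poly n y) (n - Suc s)) \<le> 0"
      using next_coeff_diff[OF ns, of x y] X_D(3)[OF X(1)] X_D(3)[OF X(2)] xy(3)
      by (simp add: height_def)
    then show ?thesis by (simp add: mult_le_0_iff del: of_nat_Suc)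
  qed
  have "minimal_in n s (stratum B) (root_poly n u)"
    using compare B by (auto simp: minimal_in_def stratum_def)
  moreover have "maximal_in n s (stratum B) (root_poly n v)"
    using compare B by (auto simp: maximal_in_def stratum_def)
  ultimately show ?thesis
    using uv unfolding order_p_gen_def slice_facets_eq by blast
qed

lemma path_in_order_p:
  assumes "(u, v) \<in> (edge True)\<^sup>*" "u \<in> vertices" "v \<in> vertices"
  shows "({root_poly n u}, {root_poly n v}) \<in> order_p n s F"
proof -
  have "({root_poly n u}, {root_poly n v}) \<in> (order_p_gen n s F)\<^sup>*"
    using assms(1)
  proof (induction rule: rtrancl_induct)
    case (step y z)
    then show ?case using edge_in_order_p_gen by (meson rtrancl.rtrancl_into_rtrancl)
  qed simp
  then show ?thesis using assms unfolding order_p_def slice_facets_eq by blast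
qed

lemma both_orders_shell:
  assumes r: "linear_order_on (slice_facets n s F) r" and fine: "order_p n s F \<subseteq> r"
    and ne: "x0 \<in> root_vectors n"
  shows "induces_shelling (boundary_complex n s F) (\<supseteq>) (slice_facets n s F) r"
    and "induces_shelling (boundary_complex n s F) (\<supseteq>) (slice_facets n s F) (r\<inverse>)"
proof -
  have X: "X \<noteq> {}" using ne by (auto simp: moment_slice_def)
  have flip: "edge False = (edge True)\<inverse>" using edge_flip[of _ _ True] by auto
  show "induces_shelling (boundary_complex n s F) (\<supseteq>) (slice_facets n s F) r"
    unfolding boundary_complex_eq slice_facets_eq
    using r fine path_in_order_p
    by (intro induces_shelling_linear_order[OF X, where e = True]) (auto simp: slice_facets_eq)
  show "induces_shelling (boundary_complex n s F) (\<supseteq>) (slice_facets n s F) (r\<inverse>)"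
    unfolding boundary_complex_eq slice_facets_eq
  proof (rule induces_shelling_linear_order[OF X, where e = False])
    show "linear_order_on {{root_poly n x} |x. x \<in> vertices} (r\<inverse>)" using r by (simp add: slice_facets_eq)
    fix u v assume "u \<in> vertices" "v \<in> vertices" "(u, v) \<in> (edge False)\<^sup>*"
    then show "({root_poly n u}, {root_poly n v}) \<in> r\<inverse>"
      using path_in_order_p[of v u] fine by (auto simp: flip rtrancl_converse)
  qed
qed

end

theorem theorem3p6:
  fixes n s :: nat
    and F :: "real poly"
    and r :: "real poly set rel"
  assumes "2 \<le> s" and "s \<le> n"
    and "F \<in> monic_hyperbolic n"
    and "generic_slice n s F"
    and "linear_order_on (slice_facets n s F) r"
    and "order_p n s F \<subseteq> r"
  shows "induces_shelling (boundary_complex n s F) (\<supseteq>) (slice_facets n s F) r \<and>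
         induces_shelling (boundary_complex n s F) (\<supseteq>) (slice_facets n s F) (r\<inverse>)"
proof -
  obtain x0 where "x0 \<in> root_vectors n" "F = root_poly n x0"
    using assms(3) monic_hyperbolic_eq by blast
  then show ?thesis using both_orders_shell[OF assms(1,2,4)] assms(5,6) by blast
qed

end
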